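(* For $n\ge1$ let $f(n)$ and $g(n)$ be the numbers of elements of the congruence lattices of $\operatorname{sTam}_n$ and $\operatorname{esTam}_n$ respectively, and set $f(0)=g(0)=1$. For sequences $(a_i)_{i\ge0}$, $(\lambda_i)_{i\ge1}$ of integers let $$F(a_0,a_1,\ldots;\lambda_1,\lambda_2,\ldots):=\cfrac{1}{1+a_0x-\cfrac{\lambda_1x}{1+a_1x-\cfrac{\lambda_2x}{1+a_2x-\ddots}}}$$ as a formal power series in $x$. Then: (1) $\sum_{n\ge0}f(n)x^n=F(a_0,a_1,\ldots;\lambda_1,\lambda_2,\ldots)$ with $(a_i)_{i\ge0}=(0,0,1,1,1,\ldots)$ (that is, $a_0=a_1=0$ and $a_i=1$ for $i\ge2$) and $(\lambda_i)_{i\ge1}=(1,1,4,4,4,\ldots)$ (that is, $\lambda_1=\lambda_2=1$ and $\lambda_i=4$ for $i\ge3$); (2) $\sum_{n\ge0}g(n)x^n=F(a_0,a_1,\ldots;\lambda_1,\lambda_2,\ldots)$ with $(a_i)_{i\ge0}=(0,1,1,2,4,8,16,\ldots)$ (that is, $a_0=0$, $a_1=1$ and $a_i=2^{i-2}$ for $i\ge2$) and $(\lambda_i)_{i\ge1}=(1,4,8,16,32,64,\ldots)$ (that is, $\lambda_1=1$ and $\lambda_i=2^i$ for $i\ge2$).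
   Context: Let $n$ be a positive integer. The board of size $n$ is the Ferrers diagram of shape $(n,n,n-1,n-2,\dots,3,2)$ (a single cell $(1,1)$ if $n=1$). Its cells are written $(i,j)$, where $i$ is the row, numbered from the top, and $j$ is the column label, the columns being labelled $n,n-1,\dots,1$ from left to right. So the cells are $(1,j)$ for $1\le j\le n$ and $(i,j)$ for $2\le i\le n$, $i-1\le j\le n$. The root is $(1,n)$ (top-left cell); the border cells are $(i,i-1)$ for $2\le i\le n$ (the rightmost cells of rows $2,\dots,n$). An fb-tableau of size $n$ is a filling in which each cell is either empty or nonempty such that the root and all border cells are nonempty, and every nonempty cell other than the root has a nonempty cell strictly to its left in the same row or strictly above it in the same column. In an fb-tableau, a nonempty cell different from the root is called a left-arrow if there is no nonempty cell strictly to its left in its row, an up-arrow if there is no nonempty cell strictly above it in its column, and a dot otherwise; the root is also a dot. (Each of rows $2,\dots,n$ has exactly one left-arrow, each of columns $1,\dots,n-1$ has exactly one up-arrow.) A cell is free in $T$ if it lies strictly below an up-arrow (same column) and strictly to the right of a left-arrow (same row); a free cell is either empty or contains a dot. $\operatorname{Row}(T)$ is the set of cells lying weakly to the right of a left-arrow or of the root in the same row; $\operatorname{Col}(T)$ is the set of cells lying weakly below an up-arrow or the root in the same column. For fb-tableaux $S,T$ of size $n$, write $S\lhd T$ if (1) $\operatorname{Col}(S)\subseteq\operatorname{Col}(T)$; (2) $\operatorname{Row}(T)\subseteq\operatorname{Row}(S)$; (3) for every cell $c$ that is free in both $S$ and $T$, if $c$ contains a dot in $S$ then $c$ contains a dot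 in $T$. The extra slow Tamari lattice $\operatorname{esTam}_n$ is the set of fb-tableaux of size $n$ ordered by $\lhd$; it is a finite lattice. An fb-tableau is small if its only dot is the root (equivalently, all its free cells are empty); the slow Tamari lattice $\operatorname{sTam}_n$ is the sublattice of small fb-tableaux of size $n$. A congruence of a lattice is an equivalence relation compatible with $\wedge$ and $\vee$; the congruence lattice is the set of all congruences ordered by inclusion. The infinite continued fraction denotes the coefficientwise limit of its finite truncations. *)

theory Defs
  imports "HOL-Algebra.Lattice" "HOL-Computational_Algebra.Formal_Power_Series"
begin

(* A cell (i, j) has row i, counted from the top, and column label j.  Columns are labelled
   n, ..., 1 from left to right, so "strictly to the left" means a strictly larger label. *)

type_synonym cell = "nat \<times> nat"

definition board :: "nat \<Rightarrow> cell set" where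
  "board n = {(1, j) |j. 1 \<le> j \<and> j \<le> n} \<union> {(i, j) |i j. 2 \<le> i \<and> i \<le> n \<and> i - 1 \<le> j \<and> j \<le> n}"

definition root :: "nat \<Rightarrow> cell" where
  "root n = (1, n)"

definition border :: "nat \<Rightarrow> cell set" where
  "border n = {(i, i - 1) |i. 2 \<le> i \<and> i \<le> n}"

definition left_of :: "cell \<Rightarrow> cell \<Rightarrow> bool" where
  "left_of c d \<longleftrightarrow> fst c = fst d \<and> snd c > snd d"

definition above :: "cell \<Rightarrow> cell \<Rightarrow> bool" where
  "above c d \<longleftrightarrow> snd c = snd d \<and> fst c < fst d"

(* A filling is represented by the set T of its nonempty cells. *)

definition fb_tableau :: "nat \<Rightarrow> cell set \<Rightarrow> bool" where
  "fb_tableau n T \<longleftrightarrow> T \<subseteq> board n \<and> root n \<in> T \<and> border n \<subseteq> T \<and>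
     (\<forall>c\<in>T. c \<noteq> root n \<longrightarrow> (\<exists>d\<in>T. left_of d c \<or> above d c))"

definition left_arrow :: "nat \<Rightarrow> cell set \<Rightarrow> cell \<Rightarrow> bool" where
  "left_arrow n T c \<longleftrightarrow> c \<in> T \<and> c \<noteq> root n \<and> \<not> (\<exists>d\<in>T. left_of d c)"

definition up_arrow :: "nat \<Rightarrow> cell set \<Rightarrow> cell \<Rightarrow> bool" where
  "up_arrow n T c \<longleftrightarrow> c \<in> T \<and> c \<noteq> root n \<and> \<not> (\<exists>d\<in>T. above d c)"

definition dot :: "nat \<Rightarrow> cell set \<Rightarrow> cell \<Rightarrow> bool" where
  "dot n T c \<longleftrightarrow> c \<in> T \<and> \<not> left_arrow n T c \<and> \<not> up_arrow n T c"

definition free_cell :: "nat \<Rightarrow> cell set \<Rightarrow> cell \<Rightarrow> bool" where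
  "free_cell n T c \<longleftrightarrow> c \<in> board n \<and>
     (\<exists>u. up_arrow n T u \<and> above u c) \<and> (\<exists>l. left_arrow n T l \<and> left_of l c)"

definition Row :: "nat \<Rightarrow> cell set \<Rightarrow> cell set" where
  "Row n T = {c \<in> board n. \<exists>d. (left_arrow n T d \<or> d = root n) \<and> (d = c \<or> left_of d c)}"

definition Col :: "nat \<Rightarrow> cell set \<Rightarrow> cell set" where
  "Col n T = {c \<in> board n. \<exists>d. (up_arrow n T d \<or> d = root n) \<and> (d = c \<or> above d c)}"

definition tableau_le :: "nat \<Rightarrow> cell set \<Rightarrow> cell set \<Rightarrow> bool" where
  "tableau_le n S T \<longleftrightarrow> Col n S \<subseteq> Col n T \<and> Row n T \<subseteq> Row n S \<and>
     (\<forall>c. free_cell n S c \<and> free_cell n T c \<and> dot n S c \<longrightarrow> dot n T c)"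

definition small :: "nat \<Rightarrow> cell set \<Rightarrow> bool" where
  "small n T \<longleftrightarrow> {c. dot n T c} = {root n}"

definition esTam :: "nat \<Rightarrow> cell set gorder" where
  "esTam n = \<lparr>carrier = {T. fb_tableau n T}, eq = (=), le = tableau_le n\<rparr>"

definition sTam :: "nat \<Rightarrow> cell set gorder" where
  "sTam n = \<lparr>carrier = {T. fb_tableau n T \<and> small n T}, eq = (=), le = tableau_le n\<rparr>"

definition congruence :: "('a, 'b) gorder_scheme \<Rightarrow> ('a \<times> 'a) set \<Rightarrow> bool" where
  "congruence L \<theta> \<longleftrightarrow> equiv (carrier L) \<theta> \<and>
     (\<forall>x x' y y'. (x, x') \<in> \<theta> \<and> (y, y') \<in> \<theta> \<longrightarrow>
        (x \<sqinter>\<^bsub>L\<^esub> y, x' \<sqinter>\<^bsub>L\<^esub> y') \<in> \<theta> \<and> (x \<squnion>\<^bsub>L\<^esub> y, x' \<squnion>\<^bsub>L\<^esub> y') \<in> \<theta>)"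

definition congruence_lattice :: "('a, 'b) gorder_scheme \<Rightarrow> ('a \<times> 'a) set gorder" where
  "congruence_lattice L = \<lparr>carrier = {\<theta>. congruence L \<theta>}, eq = (=), le = (\<subseteq>)\<rparr>"

definition num_cong_sTam :: "nat \<Rightarrow> nat" where
  "num_cong_sTam n = (if n = 0 then 1 else card (carrier (congruence_lattice (sTam n))))"

definition num_cong_esTam :: "nat \<Rightarrow> nat" where
  "num_cong_esTam n = (if n = 0 then 1 else card (carrier (congruence_lattice (esTam n))))"

(* cf_denom a l k i is the finite fraction
     1 + a_i x - l_(i+1) x / (1 + a_(i+1) x - ... - l_(i+k) x / (1 + a_(i+k) x)).
   The value l 0 is never used.  Integers are mapped into the rationals because formal power
   series have division only over a field. *)

fun cf_denom :: "(nat \<Rightarrow> int) \<Rightarrow> (nat \<Rightarrow> int) \<Rightarrow> nat \<Rightarrow> nat \<Rightarrow> rat fps" where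
  "cf_denom a l 0 i = 1 + of_int (a i) * fps_X"
| "cf_denom a l (Suc k) i =
     1 + of_int (a i) * fps_X - of_int (l (i + 1)) * fps_X / cf_denom a l k (i + 1)"

definition cf_truncation :: "(nat \<Rightarrow> int) \<Rightarrow> (nat \<Rightarrow> int) \<Rightarrow> nat \<Rightarrow> rat fps" where
  "cf_truncation a l k = 1 / cf_denom a l k 0"

(* The limit is taken in the metric dist f g = 2^(-subdegree (f - g)) on formal power series,
   in which convergence means that every coefficient is eventually constant. *)

definition cont_frac :: "(nat \<Rightarrow> int) \<Rightarrow> (nat \<Rightarrow> int) \<Rightarrow> rat fps" where
  "cont_frac a l = lim (cf_truncation a l)"

end

theory Submission
  imports Defs
begin

text \<open>
  To each cell \<open>(i, j)\<close> below the top row and off the column \<open>n\<close> a tableau assigns a height: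
  0 if no nonempty cell lies above it, 1 or 2 if it is free and empty or dotted, and 3 if a
  nonempty cell lies above it but none to its left. Recording that the height is at least \<open>t\<close> by
  the item \<open>(i, j, t)\<close> identifies the order on tableaux with inclusion on the closed sets of
  a closure system on items, in which meet is intersection.

  A congruence of the lattice of a finite closure system is determined by the set of points it
  collapses. Here the possible collapsed sets are the ideals of a forcing relation between neighbouring
  cells: \<open>(i, j, 3)\<close> forces every item of \<open>(i, j + 1)\<close>, and the lowest item of \<open>(i + 1, j)\<close>
  forces every item of \<open>(i, j)\<close>.

  In an ideal, the cells with all their items present are bounded by a Dyck path. Peeling off one row
  or one column of the triangle gives a recurrence for the number of ideals which is that of paths
  with weighted up, down and level steps, and such paths are enumerated by the continued fraction.
\<close>

section \<open>Congruences of finite closure systems\<close>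

text \<open>Along the order \<open>Col\<close> grows and \<open>Row\<close> shrinks, so heights only
  increase; this is why two opposite inclusions and the dot condition fit into a single inclusion.
  The obstacle is that height 0 hides whether a nonempty cell lies to the left. That information is
  recovered from the items 3 weakly to the right in the same row, because a left-arrow off column
  \<open>n\<close> has height 3.

  Only one closure rule has two premises; without it closed sets would be stable under union and the
  lattice distributive. Both forcing relations come from this rule, by keeping one premise in a
  closed set and adding the other.

  In the count, items of a peeled row or column that neither force nor are forced any more give
  factors of two. A peeled row contributes at most one of them and a peeled column several, which is
  how each \<lambda>_i splits into a down factor and an up factor. That the first cell of a row is
  not complete is imposed by subtraction, hence the sign with which a_i enters.\<close>

locale closure_system =
  fixes P :: "'a set" and F :: "'a set set"
  assumes finite_ground: "finite P"
    and subset_ground: "X \<in> F \<Longrightarrow> X \<subseteq> P"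
    and ground_closed: "P \<in> F"
    and Int_closed: "X \<in> F \<Longrightarrow> Y \<in> F \<Longrightarrow> X \<inter> Y \<in> F"
begin

abbreviation cl :: "'a set \<Rightarrow> 'a set" where
  "cl X \<equiv> (\<lambda>Y. Y \<in> F) hull X"

lemma finite_closed_sets: "finite F"
  using finite_ground subset_ground by (metis Pow_iff finite_Pow_iff finite_subset subsetI)

lemma Inter_closed: "finite G \<Longrightarrow> G \<noteq> {} \<Longrightarrow> G \<subseteq> F \<Longrightarrow> \<Inter>G \<in> F"
  by (induction G rule: finite_ne_induct) (auto intro: Int_closed)

lemma cl_closed: "X \<subseteq> P \<Longrightarrow> cl X \<in> F"
  unfolding hull_def
  by (rule Inter_closed) (use finite_closed_sets ground_closed in auto)

lemma cl_least: "X \<subseteq> Y \<Longrightarrow> Y \<in> F \<Longrightarrow> cl X \<subseteq> Y"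
  by (rule hull_minimal)

definition set_congruence :: "('a set \<times> 'a set) set \<Rightarrow> bool" where
  "set_congruence \<theta> \<longleftrightarrow> equiv F \<theta> \<and>
     (\<forall>X X' Y Y'. (X, X') \<in> \<theta> \<and> (Y, Y') \<in> \<theta> \<longrightarrow>
        (X \<inter> Y, X' \<inter> Y') \<in> \<theta> \<and> (cl (X \<union> Y), cl (X' \<union> Y')) \<in> \<theta>)"

text \<open>A point \<open>p\<close> stands for the closed set \<open>cl {p}\<close>. This is the
  set of contracted join-irreducibles that determines a congruence of a finite lattice.\<close>

definition collapsed :: "('a set \<times> 'a set) set \<Rightarrow> 'a set" where
  "collapsed \<theta> = {p. \<exists>X Y. (X, Y) \<in> \<theta> \<and> p \<in> Y - X}"

definition agree_outside :: "'a set \<Rightarrow> ('a set \<times> 'a set) set" where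
  "agree_outside I = {(X, Y). X \<in> F \<and> Y \<in> F \<and> X - Y \<subseteq> I \<and> Y - X \<subseteq> I}"

lemma set_congruenceD:
  assumes "set_congruence \<theta>"
  shows "equiv F \<theta>" "(X, X') \<in> \<theta> \<Longrightarrow> (Y, Y') \<in> \<theta> \<Longrightarrow> (X \<inter> Y, X' \<inter> Y') \<in> \<theta>"
    "(X, X') \<in> \<theta> \<Longrightarrow> (Y, Y') \<in> \<theta> \<Longrightarrow> (cl (X \<union> Y), cl (X' \<union> Y')) \<in> \<theta>"
    "X \<in> F \<Longrightarrow> (X, X) \<in> \<theta>" "(X, Y) \<in> \<theta> \<Longrightarrow> (Y, X) \<in> \<theta>"
    "(X, Y) \<in> \<theta> \<Longrightarrow> (Y, Z) \<in> \<theta> \<Longrightarrow> (X, Z) \<in> \<theta>"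
    "(X, Y) \<in> \<theta> \<Longrightarrow> X \<in> F \<and> Y \<in> F"
proof -
  have e: "equiv F \<theta>" using assms unfolding set_congruence_def by blast
  show "equiv F \<theta>" by (rule e)
  show "(X, X') \<in> \<theta> \<Longrightarrow> (Y, Y') \<in> \<theta> \<Longrightarrow> (X \<inter> Y, X' \<inter> Y') \<in> \<theta>"
    "(X, X') \<in> \<theta> \<Longrightarrow> (Y, Y') \<in> \<theta> \<Longrightarrow> (cl (X \<union> Y), cl (X' \<union> Y')) \<in> \<theta>"
    using assms unfolding set_congruence_def by blast+
  show "X \<in> F \<Longrightarrow> (X, X) \<in> \<theta>" "(X, Y) \<in> \<theta> \<Longrightarrow> (Y, X) \<in> \<theta>"
    "(X, Y) \<in> \<theta> \<Longrightarrow> (Y, Z) \<in> \<theta> \<Longrightarrow> (X, Z) \<in> \<theta>"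
    using e unfolding equiv_def by (meson refl_onD symD transD)+
  show "(X, Y) \<in> \<theta> \<Longrightarrow> X \<in> F \<and> Y \<in> F"
    using equiv_type[OF e] by blast
qed

text \<open>Meeting a pair that separates \<open>p\<close> with \<open>cl {p}\<close> moves the
  collapse right below \<open>cl {p}\<close>, so the witness can be taken inside
  \<open>cl {p}\<close>.\<close>

lemma collapsed_point:
  assumes c: "set_congruence \<theta>" and p: "p \<in> collapsed \<theta>"
  obtains Z where "Z \<in> F" "(Z, cl {p}) \<in> \<theta>" "Z \<subseteq> cl {p}" "p \<notin> Z" "p \<in> P"
proof -
  obtain A B where AB: "(A, B) \<in> \<theta>" "p \<in> B - A"
    using p unfolding collapsed_def by blast
  have F: "A \<in> F" "B \<in> F"
    using set_congruenceD(7)[OF c AB(1)] by auto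
  then have pP: "p \<in> P"
    using AB(2) subset_ground by blast
  have J: "cl {p} \<in> F" "cl {p} \<subseteq> B"
    using pP AB(2) F by (simp_all add: cl_closed cl_least)
  have "(cl {p} \<inter> A, cl {p} \<inter> B) \<in> \<theta>"
    by (rule set_congruenceD(2)[OF c set_congruenceD(4)[OF c J(1)] AB(1)])
  moreover have "cl {p} \<inter> B = cl {p}"
    using J(2) by blast
  ultimately show ?thesis
    using that[of "cl {p} \<inter> A"] AB(2) F J pP by (auto intro: Int_closed)
qed

text \<open>Climb from \<open>X\<close> to \<open>Y\<close>, each time joining \<open>cl {p}\<close>
  for a missing point \<open>p\<close> with smallest closure. Up to congruence this amounts to
  joining a set already contained in \<open>X\<close>.\<close>

lemma collapse_interval:
  assumes c: "set_congruence \<theta>"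
  shows "X \<in> F \<Longrightarrow> Y \<in> F \<Longrightarrow> X \<subseteq> Y \<Longrightarrow> Y - X \<subseteq> collapsed \<theta> \<Longrightarrow> (X, Y) \<in> \<theta>"
proof (induction "card (Y - X)" arbitrary: X rule: less_induct)
  case less
  have finY: "finite Y"
    using less.prems(2) finite_ground subset_ground finite_subset by blast
  show ?case
  proof (cases "X = Y")
    case True
    then show ?thesis using set_congruenceD(4)[OF c] less.prems by blast
  next
    case False
    then have "\<exists>p. p \<in> Y - X" using less.prems by blast
    then obtain p where p: "p \<in> Y - X"
        "\<And>q. q \<in> Y - X \<Longrightarrow> card (cl {p}) \<le> card (cl {q})"
      using ex_has_least_nat[of "\<lambda>p. p \<in> Y - X" _ "\<lambda>p. card (cl {p})"] by blast
    obtain Z where Z: "Z \<in> F" "(Z, cl {p}) \<in> \<theta>" "Z \<subseteq> cl {p}" "p \<notin> Z" "p \<in> P"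
      using collapsed_point[OF c] p(1) less.prems(4) by blast
    have JY: "cl {p} \<subseteq> Y"
      using p(1) less.prems(2) by (intro cl_least) auto
    have finJ: "finite (cl {p})"
      using JY finY finite_subset by blast
    have pJ: "p \<in> cl {p}"
      by (simp add: hull_inc)
    \<comment> \<open>Points of \<open>Z\<close> have strictly smaller closures than
      \<open>p\<close>, so by the choice of \<open>p\<close> none of them is missing from
      \<open>X\<close>.\<close>
    have ZX: "Z \<subseteq> X"
    proof
      fix q assume q: "q \<in> Z"
      have "cl {q} \<subseteq> Z"
        using q Z(1) by (intro cl_least) auto
      then have "cl {q} \<subset> cl {p}"
        using Z(3,4) pJ by blast
      then have "card (cl {q}) < card (cl {p})"
        using finJ psubset_card_mono by blast
      then show "q \<in> X"
        using p(2)[of q] q Z(3) JY by fastforce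
    qed
    let ?X = "cl (X \<union> cl {p})"
    have "X \<union> cl {p} \<subseteq> P" "X \<union> cl {p} \<subseteq> Y"
      using less.prems JY subset_ground by blast+
    then have X': "?X \<in> F" "?X \<subseteq> Y"
      using less.prems(2) by (simp_all add: cl_closed cl_least)
    have sub: "X \<subseteq> ?X" "p \<in> ?X"
      using hull_subset[of "X \<union> cl {p}"] pJ by blast+
    have "(cl (X \<union> Z), ?X) \<in> \<theta>"
      by (rule set_congruenceD(3)[OF c set_congruenceD(4)[OF c less.prems(1)] Z(2)])
    moreover have "cl (X \<union> Z) = X"
      using ZX less.prems(1) by (simp add: Un_absorb2 hull_same)
    ultimately have 1: "(X, ?X) \<in> \<theta>" by simp
    have "Y - ?X \<subset> Y - X" using sub p(1) by blast
    then have "card (Y - ?X) < card (Y - X)"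
      using finY by (meson finite_Diff psubset_card_mono)
    then have "(?X, Y) \<in> \<theta>"
      using less.hyps[of ?X] X' less.prems sub by blast
    then show ?thesis using set_congruenceD(6)[OF c 1] by blast
  qed
qed

lemma congruence_eq_agree_outside:
  assumes c: "set_congruence \<theta>"
  shows "\<theta> = agree_outside (collapsed \<theta>)"
proof (intro equalityI subrelI)
  fix X Y assume XY: "(X, Y) \<in> \<theta>"
  then show "(X, Y) \<in> agree_outside (collapsed \<theta>)"
    using set_congruenceD(5,7)[OF c XY] unfolding agree_outside_def collapsed_def by blast
next
  fix X Y assume "(X, Y) \<in> agree_outside (collapsed \<theta>)"
  then have *: "X \<in> F" "Y \<in> F" "X - Y \<subseteq> collapsed \<theta>" "Y - X \<subseteq> collapsed \<theta>"
    unfolding agree_outside_def by auto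
  have "(X \<inter> Y, X) \<in> \<theta>" "(X \<inter> Y, Y) \<in> \<theta>"
    using * by (auto intro!: collapse_interval[OF c] Int_closed)
  then show "(X, Y) \<in> \<theta>"
    using set_congruenceD(5,6)[OF c] by blast
qed

text \<open>Intersections respect agreement outside any set, so only joins need a hypothesis. The
  one-sided form suffices: it is applied with \<open>Z\<close> the join on the other side, once in
  each direction.\<close>

lemma agree_outside_congruence:
  assumes "\<And>X Y Z. X \<in> F \<Longrightarrow> Y \<in> F \<Longrightarrow> Z \<in> F \<Longrightarrow> X - Z \<subseteq> I \<Longrightarrow> Y - Z \<subseteq> I \<Longrightarrow>
             cl (X \<union> Y) - Z \<subseteq> I"
  shows "set_congruence (agree_outside I)"
  unfolding set_congruence_def
proof (intro conjI allI impI)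
  show "equiv F (agree_outside I)"
    unfolding equiv_def refl_on_def sym_def trans_def agree_outside_def by blast
next
  fix X X' Y Y' assume *: "(X, X') \<in> agree_outside I \<and> (Y, Y') \<in> agree_outside I"
  then show "(X \<inter> Y, X' \<inter> Y') \<in> agree_outside I"
    unfolding agree_outside_def using Int_closed by blast
  have F: "X \<in> F" "X' \<in> F" "Y \<in> F" "Y' \<in> F"
    using * unfolding agree_outside_def by auto
  then have C: "cl (X \<union> Y) \<in> F" "cl (X' \<union> Y') \<in> F"
    using subset_ground by (auto intro!: cl_closed)
  have sub: "X \<subseteq> cl (X \<union> Y)" "Y \<subseteq> cl (X \<union> Y)" "X' \<subseteq> cl (X' \<union> Y')" "Y' \<subseteq> cl (X' \<union> Y')"
    using hull_subset[of "X \<union> Y"] hull_subset[of "X' \<union> Y'"] by blast+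
  have "cl (X \<union> Y) - cl (X' \<union> Y') \<subseteq> I"
    by (rule assms[OF F(1,3) C(2)]) (use * sub in \<open>auto simp: agree_outside_def\<close>)
  moreover have "cl (X' \<union> Y') - cl (X \<union> Y) \<subseteq> I"
    by (rule assms[OF F(2,4) C(1)]) (use * sub in \<open>auto simp: agree_outside_def\<close>)
  ultimately show "(cl (X \<union> Y), cl (X' \<union> Y')) \<in> agree_outside I"
    using C unfolding agree_outside_def by blast
qed

text \<open>The second assumption says that \<open>cl {p}\<close> is join-irreducible with lower
  cover \<open>cl {p} - {p}\<close>; this covering pair differs in \<open>p\<close> alone and so
  witnesses its collapse.\<close>

lemma collapsed_agree_outside:
  assumes "I \<subseteq> P" and "\<And>p. p \<in> P \<Longrightarrow> cl {p} - {p} \<in> F"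
  shows "collapsed (agree_outside I) = I"
proof
  show "collapsed (agree_outside I) \<subseteq> I"
    unfolding collapsed_def agree_outside_def by blast
  show "I \<subseteq> collapsed (agree_outside I)"
  proof
    fix p assume p: "p \<in> I"
    then have "(cl {p} - {p}, cl {p}) \<in> agree_outside I"
      unfolding agree_outside_def using assms cl_closed[of "{p}"] by blast
    moreover have "p \<in> cl {p} - (cl {p} - {p})"
      by (simp add: hull_inc)
    ultimately show "p \<in> collapsed (agree_outside I)"
      unfolding collapsed_def by blast
  qed
qed

lemma card_set_congruences:
  assumes "\<And>\<theta>. set_congruence \<theta> \<Longrightarrow> collapsed \<theta> \<in> \<I>"
    and "\<And>I. I \<in> \<I> \<Longrightarrow> set_congruence (agree_outside I)"
    and "\<And>I. I \<in> \<I> \<Longrightarrow> collapsed (agree_outside I) = I"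
  shows "card {\<theta>. set_congruence \<theta>} = card \<I>"
proof -
  have "bij_betw collapsed {\<theta>. set_congruence \<theta>} \<I>"
    by (rule bij_betw_byWitness[where f' = agree_outside])
       (use assms congruence_eq_agree_outside in auto)
  then show ?thesis by (rule bij_betw_same_card)
qed

text \<open>An order isomorphism carries meets and joins to intersections and closures of unions,
  and therefore carries congruences to congruences.\<close>

lemma card_congruences:
  fixes L :: "'b gorder" and \<phi> :: "'b \<Rightarrow> 'a set"
  assumes eq: "eq L = (=)" and bij: "bij_betw \<phi> (carrier L) F"
    and le: "\<And>x y. x \<in> carrier L \<Longrightarrow> y \<in> carrier L \<Longrightarrow> x \<sqsubseteq>\<^bsub>L\<^esub> y \<longleftrightarrow> \<phi> x \<subseteq> \<phi> y"
  shows "card (carrier (congruence_lattice L)) = card {\<theta>. set_congruence \<theta>}"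
proof -
  let ?C = "carrier L"
  define \<psi> where "\<psi> = the_inv_into ?C \<phi>"
  have inj: "inj_on \<phi> ?C" and im: "\<phi> ` ?C = F"
    using bij unfolding bij_betw_def by auto
  have \<phi>F: "\<phi> x \<in> F" if "x \<in> ?C" for x using im that by blast
  have \<psi>C: "\<psi> X \<in> ?C" and \<phi>\<psi>: "\<phi> (\<psi> X) = X" if "X \<in> F" for X
    using that im inj unfolding \<psi>_def
    by (auto intro: the_inv_into_into intro!: f_the_inv_into_f[OF inj])
  have \<psi>\<phi>: "\<psi> (\<phi> x) = x" if "x \<in> ?C" for x
    using that inj unfolding \<psi>_def by (rule the_inv_into_f_f[rotated])
  have meet: "x \<sqinter>\<^bsub>L\<^esub> y \<in> ?C \<and> \<phi> (x \<sqinter>\<^bsub>L\<^esub> y) = \<phi> x \<inter> \<phi> y" if xy: "x \<in> ?C" "y \<in> ?C" for x y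
  proof -
    have I: "\<phi> x \<inter> \<phi> y \<in> F" using xy \<phi>F Int_closed by blast
    have 1: "greatest L (\<psi> (\<phi> x \<inter> \<phi> y)) (Lower L {x, y})"
      unfolding greatest_def Lower_def using xy \<psi>C[OF I] \<phi>\<psi>[OF I] le by auto
    \<comment> \<open>Meets and joins in the order are picked by Hilbert choice, so existence must
      be supplemented by uniqueness.\<close>
    have 2: "g = \<psi> (\<phi> x \<inter> \<phi> y)" if g: "greatest L g (Lower L {x, y})" for g
    proof -
      have gc: "g \<in> ?C" using g unfolding greatest_def Lower_def by blast
      have "g \<sqsubseteq>\<^bsub>L\<^esub> \<psi> (\<phi> x \<inter> \<phi> y)" "\<psi> (\<phi> x \<inter> \<phi> y) \<sqsubseteq>\<^bsub>L\<^esub> g"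
        using g 1 unfolding greatest_def by blast+
      then have "\<phi> g = \<phi> x \<inter> \<phi> y"
        using le gc \<psi>C[OF I] \<phi>\<psi>[OF I] by auto
      then show ?thesis using \<psi>\<phi>[OF gc] by simp
    qed
    have "x \<sqinter>\<^bsub>L\<^esub> y = \<psi> (\<phi> x \<inter> \<phi> y)"
      unfolding meet_def inf_def by (rule some_equality, rule 1, erule 2)
    then show ?thesis using \<psi>C[OF I] \<phi>\<psi>[OF I] by simp
  qed
  have join: "x \<squnion>\<^bsub>L\<^esub> y \<in> ?C \<and> \<phi> (x \<squnion>\<^bsub>L\<^esub> y) = cl (\<phi> x \<union> \<phi> y)" if xy: "x \<in> ?C" "y \<in> ?C" for x y
  proof -
    have I: "cl (\<phi> x \<union> \<phi> y) \<in> F" using xy \<phi>F subset_ground by (intro cl_closed) blast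
    have ub: "\<phi> x \<subseteq> cl (\<phi> x \<union> \<phi> y)" "\<phi> y \<subseteq> cl (\<phi> x \<union> \<phi> y)"
      using hull_subset[of "\<phi> x \<union> \<phi> y"] by blast+
    have 1: "least L (\<psi> (cl (\<phi> x \<union> \<phi> y))) (Upper L {x, y})"
    proof -
      have "\<psi> (cl (\<phi> x \<union> \<phi> y)) \<sqsubseteq>\<^bsub>L\<^esub> z"
        if "z \<in> ?C" "x \<sqsubseteq>\<^bsub>L\<^esub> z" "y \<sqsubseteq>\<^bsub>L\<^esub> z" for z
      proof -
        have "\<phi> x \<union> \<phi> y \<subseteq> \<phi> z" using that xy le by simp
        then show ?thesis
          unfolding le[OF \<psi>C[OF I] that(1)] \<phi>\<psi>[OF I] by (rule cl_least[OF _ \<phi>F[OF that(1)]])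
      qed
      moreover have "x \<sqsubseteq>\<^bsub>L\<^esub> \<psi> (cl (\<phi> x \<union> \<phi> y))" "y \<sqsubseteq>\<^bsub>L\<^esub> \<psi> (cl (\<phi> x \<union> \<phi> y))"
        using le[OF _ \<psi>C[OF I]] \<phi>\<psi>[OF I] xy ub by simp_all
      ultimately show ?thesis
        unfolding least_def Upper_def using xy \<psi>C[OF I] by auto
    qed
    have 2: "g = \<psi> (cl (\<phi> x \<union> \<phi> y))" if g: "least L g (Upper L {x, y})" for g
    proof -
      have gc: "g \<in> ?C" using g unfolding least_def Upper_def by blast
      have "g \<sqsubseteq>\<^bsub>L\<^esub> \<psi> (cl (\<phi> x \<union> \<phi> y))" "\<psi> (cl (\<phi> x \<union> \<phi> y)) \<sqsubseteq>\<^bsub>L\<^esub> g"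
        using g 1 unfolding least_def by blast+
      then have "\<phi> g = cl (\<phi> x \<union> \<phi> y)"
        using le gc \<psi>C[OF I] \<phi>\<psi>[OF I] by auto
      then show ?thesis using \<psi>\<phi>[OF gc] by simp
    qed
    have "x \<squnion>\<^bsub>L\<^esub> y = \<psi> (cl (\<phi> x \<union> \<phi> y))"
      unfolding join_def sup_def by (rule some_equality, rule 1, erule 2)
    then show ?thesis using \<psi>C[OF I] \<phi>\<psi>[OF I] by simp
  qed
  have fwd: "set_congruence (map_prod \<phi> \<phi> ` \<theta>)" if c: "congruence L \<theta>" for \<theta>
  proof -
    have e: "equiv ?C \<theta>" using c unfolding congruence_def by blast
    then have sub: "\<theta> \<subseteq> ?C \<times> ?C" by (rule equiv_type)
    have mem: "(X, Y) \<in> map_prod \<phi> \<phi> ` \<theta> \<longleftrightarrow> X \<in> F \<and> Y \<in> F \<and> (\<psi> X, \<psi> Y) \<in> \<theta>" for X Y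
    proof
      assume "(X, Y) \<in> map_prod \<phi> \<phi> ` \<theta>"
      then show "X \<in> F \<and> Y \<in> F \<and> (\<psi> X, \<psi> Y) \<in> \<theta>" using sub \<phi>F \<psi>\<phi> by auto
    next
      assume *: "X \<in> F \<and> Y \<in> F \<and> (\<psi> X, \<psi> Y) \<in> \<theta>"
      then have "map_prod \<phi> \<phi> (\<psi> X, \<psi> Y) \<in> map_prod \<phi> \<phi> ` \<theta>" by blast
      then show "(X, Y) \<in> map_prod \<phi> \<phi> ` \<theta>" using * \<phi>\<psi> by simp
    qed
    have refl: "(x, x) \<in> \<theta>" if "x \<in> ?C" for x
      using e that unfolding equiv_def by (meson refl_onD)
    have "equiv F (map_prod \<phi> \<phi> ` \<theta>)"
    proof (rule equivI)
      show "map_prod \<phi> \<phi> ` \<theta> \<subseteq> F \<times> F" using sub \<phi>F by auto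
      show "refl_on F (map_prod \<phi> \<phi> ` \<theta>)"
        by (rule refl_onI) (simp add: mem refl \<psi>C)
      show "sym (map_prod \<phi> \<phi> ` \<theta>)"
        by (rule symI) (use e mem in \<open>auto simp: equiv_def dest: symD\<close>)
      show "trans (map_prod \<phi> \<phi> ` \<theta>)"
        by (rule transI) (use e mem in \<open>auto simp: equiv_def dest: transD\<close>)
    qed
    moreover have "\<psi> (X \<inter> Y) = \<psi> X \<sqinter>\<^bsub>L\<^esub> \<psi> Y" "\<psi> (cl (X \<union> Y)) = \<psi> X \<squnion>\<^bsub>L\<^esub> \<psi> Y"
      "X \<inter> Y \<in> F" "cl (X \<union> Y) \<in> F" if "X \<in> F" "Y \<in> F" for X Y
    proof -
      note m = meet[OF \<psi>C[OF that(1)] \<psi>C[OF that(2)], unfolded \<phi>\<psi>[OF that(1)] \<phi>\<psi>[OF that(2)]]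
      note j = join[OF \<psi>C[OF that(1)] \<psi>C[OF that(2)], unfolded \<phi>\<psi>[OF that(1)] \<phi>\<psi>[OF that(2)]]
      show "\<psi> (X \<inter> Y) = \<psi> X \<sqinter>\<^bsub>L\<^esub> \<psi> Y" "\<psi> (cl (X \<union> Y)) = \<psi> X \<squnion>\<^bsub>L\<^esub> \<psi> Y"
        using m j \<psi>\<phi> by force+
      show "X \<inter> Y \<in> F" "cl (X \<union> Y) \<in> F"
        using m j \<phi>F by force+
    qed
    ultimately show ?thesis
      unfolding set_congruence_def mem using c unfolding congruence_def by simp
  qed
  have bwd: "congruence L (map_prod \<psi> \<psi> ` \<theta>)" if c: "set_congruence \<theta>" for \<theta>
  proof -
    have e: "equiv F \<theta>" using c unfolding set_congruence_def by blast
    then have sub: "\<theta> \<subseteq> F \<times> F" by (rule equiv_type)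
    have mem: "(x, y) \<in> map_prod \<psi> \<psi> ` \<theta> \<longleftrightarrow> x \<in> ?C \<and> y \<in> ?C \<and> (\<phi> x, \<phi> y) \<in> \<theta>" for x y
    proof
      assume "(x, y) \<in> map_prod \<psi> \<psi> ` \<theta>"
      then show "x \<in> ?C \<and> y \<in> ?C \<and> (\<phi> x, \<phi> y) \<in> \<theta>" using sub \<psi>C \<phi>\<psi> by auto
    next
      assume "x \<in> ?C \<and> y \<in> ?C \<and> (\<phi> x, \<phi> y) \<in> \<theta>"
      moreover from this have "map_prod \<psi> \<psi> (\<phi> x, \<phi> y) \<in> map_prod \<psi> \<psi> ` \<theta>" by blast
      ultimately show "(x, y) \<in> map_prod \<psi> \<psi> ` \<theta>" using \<psi>\<phi> by simp
    qed
    have refl: "(X, X) \<in> \<theta>" if "X \<in> F" for X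
      using e that unfolding equiv_def by (meson refl_onD)
    have "equiv ?C (map_prod \<psi> \<psi> ` \<theta>)"
    proof (rule equivI)
      show "map_prod \<psi> \<psi> ` \<theta> \<subseteq> ?C \<times> ?C" using sub \<psi>C by auto
      show "refl_on ?C (map_prod \<psi> \<psi> ` \<theta>)"
        by (rule refl_onI) (simp add: mem refl \<phi>F)
      show "sym (map_prod \<psi> \<psi> ` \<theta>)"
        by (rule symI) (use e mem in \<open>auto simp: equiv_def dest: symD\<close>)
      show "trans (map_prod \<psi> \<psi> ` \<theta>)"
        by (rule transI) (use e mem in \<open>auto simp: equiv_def dest: transD\<close>)
    qed
    then show ?thesis
      unfolding congruence_def mem using meet join c unfolding set_congruence_def by auto
  qed
  have "bij_betw ((`) (map_prod \<phi> \<phi>)) {\<theta>. congruence L \<theta>} {\<theta>. set_congruence \<theta>}"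
  proof (rule bij_betw_byWitness[where f' = "(`) (map_prod \<psi> \<psi>)"])
    show "\<forall>\<theta>\<in>{\<theta>. congruence L \<theta>}. map_prod \<psi> \<psi> ` map_prod \<phi> \<phi> ` \<theta> = \<theta>"
    proof
      fix \<theta> assume "\<theta> \<in> {\<theta>. congruence L \<theta>}"
      then have "\<theta> \<subseteq> ?C \<times> ?C" unfolding congruence_def using equiv_type by blast
      then have "(map_prod \<psi> \<psi> \<circ> map_prod \<phi> \<phi>) z = z" if "z \<in> \<theta>" for z
        using that \<psi>\<phi> by auto
      then show "map_prod \<psi> \<psi> ` map_prod \<phi> \<phi> ` \<theta> = \<theta>"
        unfolding image_comp by (metis (no_types, lifting) image_cong image_ident)
    qed
    show "\<forall>\<theta>\<in>{\<theta>. set_congruence \<theta>}. map_prod \<phi> \<phi> ` map_prod \<psi> \<psi> ` \<theta> = \<theta>"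
    proof
      fix \<theta> assume "\<theta> \<in> {\<theta>. set_congruence \<theta>}"
      then have "\<theta> \<subseteq> F \<times> F" unfolding set_congruence_def using equiv_type by blast
      then have "(map_prod \<phi> \<phi> \<circ> map_prod \<psi> \<psi>) z = z" if "z \<in> \<theta>" for z
        using that \<phi>\<psi> by auto
      then show "map_prod \<phi> \<phi> ` map_prod \<psi> \<psi> ` \<theta> = \<theta>"
        unfolding image_comp by (metis (no_types, lifting) image_cong image_ident)
    qed
  qed (use fwd bwd in auto)
  then show ?thesis
    unfolding congruence_lattice_def by (simp add: bij_betw_same_card)
qed

end

section \<open>The closure system of marked cells and its congruences\<close>

type_synonym item = "nat \<times> nat \<times> nat"

text \<open>
  \<open>b\<close> selects all tableaux (\<open>True\<close>) or the small ones (\<open>False\<close>). A border cell \<open>(j + 1, j)\<close> is never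
  empty: when free it holds a dot, so it needs no item 2, and in a small tableau it is not free
  at all, which leaves only item 3.
\<close>

definition items :: "bool \<Rightarrow> nat \<Rightarrow> item set" where
  "items b n = {(i, j, t). 2 \<le> i \<and> i \<le> Suc j \<and> j < n \<and>
     (t = 3 \<or> t = 1 \<and> (i \<le> j \<or> b) \<or> t = 2 \<and> i \<le> j \<and> b)}"

text \<open>The item that records a nonempty cell above. For a border cell of a small tableau this
  already means height 3.\<close>

definition lowest :: "bool \<Rightarrow> nat \<Rightarrow> nat \<Rightarrow> nat" where
  "lowest b i j = (if i \<le> j \<or> b then 1 else 3)"

text \<open>The second rule holds because what lies above a cell lies above the next cell down. The
  third: if nothing is to the left of \<open>(i, k)\<close>, then \<open>(i, j)\<close> is empty
  with nothing to its left, so whatever lies above \<open>(i + 1, j)\<close> lies above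
  \<open>(i, j)\<close>, which has height 3.\<close>

definition item_closed :: "bool \<Rightarrow> nat \<Rightarrow> item set \<Rightarrow> bool" where
  "item_closed b n X \<longleftrightarrow> X \<subseteq> items b n \<and>
     (\<forall>i j s t. (i, j, t) \<in> X \<and> (i, j, s) \<in> items b n \<and> s \<le> t \<longrightarrow> (i, j, s) \<in> X) \<and>
     (\<forall>i j t. (i, j, t) \<in> X \<and> i \<le> j \<longrightarrow> (Suc i, j, lowest b (Suc i) j) \<in> X) \<and>
     (\<forall>i j k t. (i, k, 3) \<in> X \<and> k < j \<and> (Suc i, j, lowest b (Suc i) j) \<in> X \<and>
        (i, j, t) \<in> items b n \<longrightarrow> (i, j, t) \<in> X)"

text \<open>The ground set \<open>Q\<close> is a parameter because the count restricts ideals to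
  smaller and smaller regions.\<close>

definition forcing_closed :: "bool \<Rightarrow> item set \<Rightarrow> item set \<Rightarrow> bool" where
  "forcing_closed b Q I \<longleftrightarrow> I \<subseteq> Q \<and>
     (\<forall>i j t. (i, j, 3) \<in> I \<and> (i, Suc j, t) \<in> Q \<longrightarrow> (i, Suc j, t) \<in> I) \<and>
     (\<forall>i j t. (Suc i, j, lowest b (Suc i) j) \<in> I \<and> (i, j, t) \<in> Q \<longrightarrow> (i, j, t) \<in> I)"

text \<open>The closure of one item. It stays in a single column, so the closure rule relating two
  columns never fires.\<close>

definition principal :: "bool \<Rightarrow> nat \<Rightarrow> item \<Rightarrow> item set" where
  "principal b n = (\<lambda>(i, j, t). {(i, j, s) |s. (i, j, s) \<in> items b n \<and> s \<le> t} \<union>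
     {(i', j, lowest b i' j) |i'. i < i' \<and> i' \<le> Suc j})"

lemma finite_items: "finite (items b n)"
proof (rule finite_subset)
  show "items b n \<subseteq> {..n} \<times> {..n} \<times> {..3}" unfolding items_def by auto
qed simp

lemma item_closedD:
  assumes "item_closed b n X"
  shows "X \<subseteq> items b n"
    "(i, j, t) \<in> X \<Longrightarrow> (i, j, s) \<in> items b n \<Longrightarrow> s \<le> t \<Longrightarrow> (i, j, s) \<in> X"
    "(i, j, t) \<in> X \<Longrightarrow> i \<le> j \<Longrightarrow> (Suc i, j, lowest b (Suc i) j) \<in> X"
    "(i, k, 3) \<in> X \<Longrightarrow> k < j \<Longrightarrow> (Suc i, j, lowest b (Suc i) j) \<in> X \<Longrightarrow>
        (i, j, t) \<in> items b n \<Longrightarrow> (i, j, t) \<in> X"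
  using assms unfolding item_closed_def by blast+

lemma lowest_le: "(i, j, t) \<in> items b n \<Longrightarrow> lowest b i j \<le> t"
  unfolding items_def lowest_def by auto

lemma lowest_item: "(i, j, t) \<in> items b n \<Longrightarrow> (i, j, lowest b i j) \<in> items b n"
  unfolding items_def lowest_def by auto

lemma top_item: "(i, j, t) \<in> items b n \<Longrightarrow> (i, j, 3) \<in> items b n \<and> t \<le> 3"
  unfolding items_def by auto

lemma item_closed_lowest: "item_closed b n X \<Longrightarrow> (i, j, t) \<in> X \<Longrightarrow> (i, j, lowest b i j) \<in> X"
  by (meson item_closedD(1,2) lowest_item lowest_le subsetD)

lemma item_closed_column:
  assumes "item_closed b n X" "(i, j, t) \<in> X"
  shows "i \<le> i' \<Longrightarrow> i' \<le> Suc j \<Longrightarrow> (i', j, lowest b i' j) \<in> X"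
proof (induction i' rule: dec_induct)
  case base
  then show ?case using item_closed_lowest assms by blast
next
  case (step k)
  then show ?case using item_closedD(3)[OF assms(1), of k j] by simp
qed

lemma item_closed_items: "item_closed b n (items b n)"
  unfolding item_closed_def by (auto simp: items_def lowest_def)

lemma item_closed_Int:
  assumes X: "item_closed b n X" and Y: "item_closed b n Y"
  shows "item_closed b n (X \<inter> Y)"
  unfolding item_closed_def
proof (intro conjI allI impI)
  show "X \<inter> Y \<subseteq> items b n" using item_closedD(1)[OF X] by blast
next
  fix i j s t assume "(i, j, t) \<in> X \<inter> Y \<and> (i, j, s) \<in> items b n \<and> s \<le> t"
  then show "(i, j, s) \<in> X \<inter> Y" by (meson IntE IntI item_closedD(2)[OF X] item_closedD(2)[OF Y])
next
  fix i j t assume "(i, j, t) \<in> X \<inter> Y \<and> i \<le> j"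
  then show "(Suc i, j, lowest b (Suc i) j) \<in> X \<inter> Y"
    by (meson IntE IntI item_closedD(3)[OF X] item_closedD(3)[OF Y])
next
  fix i j k t
  assume "(i, k, 3) \<in> X \<inter> Y \<and> k < j \<and> (Suc i, j, lowest b (Suc i) j) \<in> X \<inter> Y \<and>
    (i, j, t) \<in> items b n"
  then show "(i, j, t) \<in> X \<inter> Y"
    by (meson IntE IntI item_closedD(4)[OF X] item_closedD(4)[OF Y])
qed

lemma closure_system_items: "closure_system (items b n) (Collect (item_closed b n))"
  by unfold_locales (auto simp: finite_items item_closed_items item_closed_Int dest: item_closedD(1))

section \<open>Closures of single items\<close>

lemma principal_self: "p \<in> items b n \<Longrightarrow> p \<in> principal b n p"
  unfolding principal_def by (cases p) auto

lemma principal_least: "item_closed b n X \<Longrightarrow> p \<in> X \<Longrightarrow> principal b n p \<subseteq> X"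
  unfolding principal_def using item_closedD(1,2) item_closed_column by (cases p) fastforce

lemma principal_closed: "p \<in> items b n \<Longrightarrow> item_closed b n (principal b n p)"
  unfolding principal_def item_closed_def
  by (cases p) (auto simp: items_def lowest_def split: if_splits)

text \<open>Within one column the rules lead only to lower items of the same cell or to cells below,
  never back to \<open>p\<close>.\<close>

lemma principal_minus_closed: "p \<in> items b n \<Longrightarrow> item_closed b n (principal b n p - {p})"
  unfolding principal_def item_closed_def
  by (cases p) (auto simp: items_def lowest_def split: if_splits)

lemma closure_principal:
  assumes "p \<in> items b n"
  shows "(\<lambda>Y. Y \<in> Collect (item_closed b n)) hull {p} = principal b n p"
  by (rule hull_unique) (use assms principal_self principal_closed principal_least in auto)

section \<open>Collapsed sets are exactly the ideals of the forcing relation\<close>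

lemma forcing_closedD:
  assumes "forcing_closed b Q I"
  shows "I \<subseteq> Q" "(i, j, 3) \<in> I \<Longrightarrow> (i, Suc j, t) \<in> Q \<Longrightarrow> (i, Suc j, t) \<in> I"
     "(Suc i, j, lowest b (Suc i) j) \<in> I \<Longrightarrow> (i, j, t) \<in> Q \<Longrightarrow> (i, j, t) \<in> I"
  using assms unfolding forcing_closed_def by blast+

lemma forcing_closed_row:
  assumes I: "forcing_closed b (items b n) I" and "(i, k, 3) \<in> I"
  shows "Suc k \<le> j \<Longrightarrow> (i, j, t) \<in> items b n \<Longrightarrow> (i, j, t) \<in> I"
proof (induction j arbitrary: t rule: dec_induct)
  case base
  then show ?case using forcing_closedD(2)[OF I assms(2)] by blast
next
  case (step j)
  have "(i, k, 3) \<in> items b n" using assms forcing_closedD(1) by blast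
  then have "(i, j, 3) \<in> items b n" using step by (auto simp: items_def)
  then show ?case using step forcing_closedD(2)[OF I] by blast
qed

lemma forcing_closed_agree:
  assumes I: "forcing_closed b (items b n) I"
  shows "closure_system.set_congruence (Collect (item_closed b n))
    (closure_system.agree_outside (Collect (item_closed b n)) I)"
proof -
  interpret closure_system "items b n" "Collect (item_closed b n)"
    by (rule closure_system_items)
  show ?thesis
  proof (rule agree_outside_congruence)
    fix X Y Z assume F: "X \<in> Collect (item_closed b n)" "Y \<in> Collect (item_closed b n)"
        "Z \<in> Collect (item_closed b n)" and sub: "X - Z \<subseteq> I" "Y - Z \<subseteq> I"
    \<comment> \<open>\<open>Z \<union> I\<close> need not be closed, but the union of the principal sets inside it is.\<close>
    define W where "W = {p \<in> items b n. principal b n p \<subseteq> Z \<union> I}"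
    have Z: "item_closed b n Z" using F by simp
    have W: "item_closed b n W"
      unfolding item_closed_def
    proof (intro conjI allI impI)
      show "W \<subseteq> items b n" unfolding W_def by blast
    next
      fix i j s t assume *: "(i, j, t) \<in> W \<and> (i, j, s) \<in> items b n \<and> s \<le> t"
      then have "principal b n (i, j, s) \<subseteq> principal b n (i, j, t)"
        unfolding principal_def by auto
      then show "(i, j, s) \<in> W" using * unfolding W_def by blast
    next
      fix i j t assume *: "(i, j, t) \<in> W \<and> i \<le> j"
      then have it: "(i, j, t) \<in> items b n" unfolding W_def by blast
      then have "(Suc i, j, lowest b (Suc i) j) \<in> principal b n (i, j, t)"
        using * unfolding principal_def by auto
      then have "principal b n (Suc i, j, lowest b (Suc i) j) \<subseteq> principal b n (i, j, t)"
        using principal_closed[OF it] principal_least by blast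
      moreover have "(Suc i, j, lowest b (Suc i) j) \<in> items b n"
        using it * by (auto simp: items_def lowest_def)
      ultimately show "(Suc i, j, lowest b (Suc i) j) \<in> W" using * unfolding W_def by blast
    next
      fix i j k t
      assume *: "(i, k, 3) \<in> W \<and> k < j \<and> (Suc i, j, lowest b (Suc i) j) \<in> W \<and> (i, j, t) \<in> items b n"
      then have mem: "(i, k, 3) \<in> items b n" "(Suc i, j, lowest b (Suc i) j) \<in> items b n"
          "principal b n (i, k, 3) \<subseteq> Z \<union> I"
          "principal b n (Suc i, j, lowest b (Suc i) j) \<subseteq> Z \<union> I"
        unfolding W_def by auto
      have "(i, k, 3) \<in> Z \<union> I" "(Suc i, j, lowest b (Suc i) j) \<in> Z \<union> I"
        using mem principal_self by blast+
      \<comment> \<open>If either premise lies in \<open>I\<close>, forcing puts the whole cell into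
        \<open>I\<close>; otherwise both lie in \<open>Z\<close>, which is closed.\<close>
      then have cell: "(i, j, s) \<in> Z \<union> I" if "(i, j, s) \<in> items b n" for s
      proof (cases "(i, k, 3) \<in> I \<or> (Suc i, j, lowest b (Suc i) j) \<in> I")
        case True
        then show ?thesis
          using forcing_closed_row[OF I, of i k j s] forcing_closedD(3)[OF I, of i j s] * that by auto
      next
        case False
        then have "(i, k, 3) \<in> Z" "(Suc i, j, lowest b (Suc i) j) \<in> Z"
          using \<open>(i, k, 3) \<in> Z \<union> I\<close> \<open>(Suc i, j, lowest b (Suc i) j) \<in> Z \<union> I\<close> by auto
        then show ?thesis
          using item_closedD(4)[OF Z, of i k j s] * that by simp
      qed
      \<comment> \<open>Outside its own cell, the principal set of \<open>(i, j, t)\<close> is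
        contained in that of the cell below.\<close>
      have "principal b n (i, j, t) \<subseteq> {(i, j, s) |s. (i, j, s) \<in> items b n} \<union>
          principal b n (Suc i, j, lowest b (Suc i) j)"
      proof -
        have "i' = Suc i \<or> Suc i < i'" if "i < i'" for i' using that by auto
        then show ?thesis using mem(2) unfolding principal_def by auto
      qed
      then show "(i, j, t) \<in> W"
        using * mem cell unfolding W_def by blast
    qed
    have "V \<subseteq> W" if "item_closed b n V" "V - Z \<subseteq> I" for V
      using that principal_least[OF that(1)] item_closedD(1)[OF that(1)] unfolding W_def by blast
    then have "X \<union> Y \<subseteq> W" using F sub by simp
    then have "cl (X \<union> Y) \<subseteq> W" using W by (intro cl_least) simp_all
    moreover have "W \<subseteq> Z \<union> I" unfolding W_def using principal_self by blast
    ultimately show "cl (X \<union> Y) - Z \<subseteq> I" by blast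
  qed
qed

text \<open>Some proper part \<open>Z\<close> of \<open>cl {p}\<close> is congruent to
  \<open>cl {p}\<close> and omits \<open>p\<close>, so it lies in \<open>M\<close>. Joining both
  with \<open>M\<close> relates \<open>M\<close> to a closed set containing
  \<open>q\<close>.\<close>

lemma collapsed_forces:
  assumes c: "closure_system.set_congruence (Collect (item_closed b n)) \<theta>"
    and p: "p \<in> closure_system.collapsed \<theta>"
    and M: "item_closed b n M" "principal b n p - {p} \<subseteq> M" "q \<notin> M"
    and q: "\<And>X. item_closed b n X \<Longrightarrow> M \<subseteq> X \<Longrightarrow> p \<in> X \<Longrightarrow> q \<in> X"
  shows "q \<in> closure_system.collapsed \<theta>"
proof -
  interpret closure_system "items b n" "Collect (item_closed b n)"
    by (rule closure_system_items)
  obtain Z where Z: "Z \<in> Collect (item_closed b n)" "(Z, cl {p}) \<in> \<theta>" "Z \<subseteq> cl {p}" "p \<notin> Z"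
      "p \<in> items b n"
    using collapsed_point[OF c p] by blast
  have J: "cl {p} = principal b n p" by (rule closure_principal[OF Z(5)])
  have "Z \<subseteq> M" using Z(3,4) M(2) J by blast
  then have "cl (M \<union> Z) = M" using M(1) by (simp add: Un_absorb2 hull_same)
  moreover have "(cl (M \<union> Z), cl (M \<union> cl {p})) \<in> \<theta>"
    using set_congruenceD(3)[OF c set_congruenceD(4)[OF c] Z(2)] M(1) by simp
  moreover have "q \<in> cl (M \<union> cl {p})"
  proof (rule q)
    have "M \<union> cl {p} \<subseteq> items b n"
      unfolding J using item_closedD(1) M(1) principal_closed[OF Z(5)] by blast
    then show "item_closed b n (cl (M \<union> cl {p}))" using cl_closed by blast
    show "M \<subseteq> cl (M \<union> cl {p})" "p \<in> cl (M \<union> cl {p})"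
      by (simp_all add: hull_inc subsetI)
  qed
  ultimately show ?thesis unfolding collapsed_def using M(3) by auto
qed

lemma collapsed_forcing_closed:
  assumes c: "closure_system.set_congruence (Collect (item_closed b n)) \<theta>"
  shows "forcing_closed b (items b n) (closure_system.collapsed \<theta>)"
  unfolding forcing_closed_def
proof (intro conjI allI impI)
  interpret closure_system "items b n" "Collect (item_closed b n)"
    by (rule closure_system_items)
  show sub: "collapsed \<theta> \<subseteq> items b n"
    using collapsed_point[OF c] by blast
  fix i j t
  {
    assume *: "(i, j, 3) \<in> collapsed \<theta> \<and> (i, Suc j, t) \<in> items b n"
    then have p: "(i, j, 3) \<in> items b n" using sub by blast
    \<comment> \<open>All lower rows supply the premise at \<open>(i + 1, j + 1)\<close> of the
      two-column rule; only the premise \<open>(i, j, 3)\<close> is withheld.\<close>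
    let ?M = "{(i', j', s). (i', j', s) \<in> items b n \<and> (i < i' \<or> i' = i \<and> j' = j \<and> s < 3)}"
    show "(i, Suc j, t) \<in> collapsed \<theta>"
    proof (rule collapsed_forces[OF c, where M = ?M])
      show "(i, j, 3) \<in> collapsed \<theta>" using * by blast
      show "item_closed b n ?M"
        unfolding item_closed_def by (auto simp: items_def lowest_def)
      show "principal b n (i, j, 3) - {(i, j, 3)} \<subseteq> ?M"
        using p unfolding principal_def by (auto simp: items_def lowest_def)
      show "(i, Suc j, t) \<notin> ?M" by simp
      fix X assume X: "item_closed b n X" "?M \<subseteq> X" "(i, j, 3) \<in> X"
      have "(Suc i, Suc j, lowest b (Suc i) (Suc j)) \<in> ?M"
        using * p by (auto simp: items_def lowest_def)
      then show "(i, Suc j, t) \<in> X"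
        using X * item_closedD(4)[OF X(1,3)] by blast
    qed
  next
    assume *: "(Suc i, j, lowest b (Suc i) j) \<in> collapsed \<theta> \<and> (i, j, t) \<in> items b n"
    then have p: "(Suc i, j, lowest b (Suc i) j) \<in> items b n" using sub by blast
    \<comment> \<open>Now the premise in row \<open>i\<close> is supplied, by item 3 of the border
      cell \<open>(i, i - 1)\<close>. Row \<open>i + 1\<close> is left out, so the rule cannot fire
      in row \<open>i\<close> before the collapsed item is added.\<close>
    let ?M = "{(i', j', s). (i', j', s) \<in> items b n \<and> (Suc i < i' \<or> i' = i \<and> Suc j' = i)}"
    show "(i, j, t) \<in> collapsed \<theta>"
    proof (rule collapsed_forces[OF c, where M = ?M])
      show "(Suc i, j, lowest b (Suc i) j) \<in> collapsed \<theta>" using * by blast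
      show "item_closed b n ?M"
        unfolding item_closed_def
      proof (intro conjI allI impI)
        fix i' j' k t
        assume "(i', k, 3) \<in> ?M \<and> k < j' \<and> (Suc i', j', lowest b (Suc i') j') \<in> ?M \<and>
          (i', j', t) \<in> items b n"
        then have "Suc i < i' \<or> i' = i" "Suc i < Suc i' \<or> Suc i' = i" "(i', j', t) \<in> items b n"
          by auto
        then show "(i', j', t) \<in> ?M" by auto
      next
        fix i' j' t assume "(i', j', t) \<in> ?M \<and> i' \<le> j'"
        then have "Suc i < i'" "(i', j', t) \<in> items b n" "i' \<le> j'" by auto
        then show "(Suc i', j', lowest b (Suc i') j') \<in> ?M"
          by (auto simp: items_def lowest_def)
      qed auto
      show "principal b n (Suc i, j, lowest b (Suc i) j) - {(Suc i, j, lowest b (Suc i) j)} \<subseteq> ?M"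
      proof
        fix x assume "x \<in> principal b n (Suc i, j, lowest b (Suc i) j) - {(Suc i, j, lowest b (Suc i) j)}"
        then consider s where "x = (Suc i, j, s)" "x \<in> items b n" "s \<le> lowest b (Suc i) j"
              "s \<noteq> lowest b (Suc i) j"
          | i' where "x = (i', j, lowest b i' j)" "Suc i < i'" "i' \<le> Suc j"
          unfolding principal_def by auto
        then show "x \<in> ?M"
        proof cases
          case 1
          then show ?thesis using lowest_le[of "Suc i" j s b n] by simp
        next
          case 2
          then show ?thesis using p by (auto simp: items_def lowest_def)
        qed
      qed
      show "(i, j, t) \<notin> ?M" using p by (auto simp: items_def)
      fix X assume X: "item_closed b n X" "?M \<subseteq> X" "(Suc i, j, lowest b (Suc i) j) \<in> X"
      have "(i, i - 1, 3) \<in> ?M" "i - 1 < j"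
        using * p by (auto simp: items_def lowest_def)
      then show "(i, j, t) \<in> X"
        using X * item_closedD(4)[OF X(1) _ _ X(3)] by blast
    qed
  }
qed

lemma card_congruences_eq_ideals:
  "card {\<theta>. closure_system.set_congruence (Collect (item_closed b n)) \<theta>} =
   card {I. forcing_closed b (items b n) I}"
proof -
  interpret closure_system "items b n" "Collect (item_closed b n)"
    by (rule closure_system_items)
  show ?thesis
  proof (rule card_set_congruences)
    show "collapsed (agree_outside I) = I" if "I \<in> {I. forcing_closed b (items b n) I}" for I
    proof (rule collapsed_agree_outside)
      show "I \<subseteq> items b n" using that forcing_closedD(1) by blast
      show "cl {p} - {p} \<in> Collect (item_closed b n)" if "p \<in> items b n" for p
        unfolding closure_principal[OF that] using principal_minus_closed[OF that] by simp
    qed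
  qed (auto simp: collapsed_forcing_closed forcing_closed_agree)
qed

section \<open>Tableaux as closed sets of items\<close>

definition in_triangle :: "nat \<Rightarrow> nat \<Rightarrow> nat \<Rightarrow> bool" where
  "in_triangle n i j \<longleftrightarrow> 2 \<le> i \<and> i \<le> Suc j \<and> j < n"

definition has_above :: "cell set \<Rightarrow> nat \<Rightarrow> nat \<Rightarrow> bool" where
  "has_above T i j \<longleftrightarrow> (\<exists>i'<i. (i', j) \<in> T)"

definition has_left :: "cell set \<Rightarrow> nat \<Rightarrow> nat \<Rightarrow> bool" where
  "has_left T i j \<longleftrightarrow> (\<exists>j'>j. (i, j') \<in> T)"

definition tableaux :: "bool \<Rightarrow> nat \<Rightarrow> cell set set" where
  "tableaux b n = {T. fb_tableau n T \<and> (b \<or> small n T)}"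

definition code :: "bool \<Rightarrow> nat \<Rightarrow> cell set \<Rightarrow> item set" where
  "code b n T = {(i, j, t). (i, j, t) \<in> items b n \<and> has_above T i j \<and>
     (t = 3 \<longrightarrow> \<not> has_left T i j) \<and> (t = 2 \<longrightarrow> \<not> has_left T i j \<or> (i, j) \<in> T)}"

lemma has_left_mono: "has_left T i j \<Longrightarrow> j' \<le> j \<Longrightarrow> has_left T i j'"
  unfolding has_left_def by (meson le_less_trans)

lemma has_above_Suc: "has_above T (Suc i) j \<longleftrightarrow> has_above T i j \<or> (i, j) \<in> T"
  unfolding has_above_def by (auto simp: less_Suc_eq)

lemma has_left_Suc: "has_left T i j \<longleftrightarrow> has_left T i (Suc j) \<or> (i, Suc j) \<in> T"
  unfolding has_left_def by (metis Suc_lessI Suc_lessD lessI)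

lemma fb_tableauD:
  assumes "fb_tableau n T"
  shows "(i, j) \<in> T \<Longrightarrow> (i, j) \<in> board n" "(1, n) \<in> T"
    "1 \<le> j \<Longrightarrow> j < n \<Longrightarrow> (Suc j, j) \<in> T"
    "(i, j) \<in> T \<Longrightarrow> (i, j) \<noteq> (1, n) \<Longrightarrow> has_left T i j \<or> has_above T i j"
proof -
  show "(i, j) \<in> T \<Longrightarrow> (i, j) \<in> board n" "(1, n) \<in> T"
    using assms unfolding fb_tableau_def root_def by auto
  have "(Suc j, j) \<in> border n" if "1 \<le> j" "j < n"
    unfolding border_def using that by (intro CollectI exI[of _ "Suc j"]) simp
  then show "1 \<le> j \<Longrightarrow> j < n \<Longrightarrow> (Suc j, j) \<in> T"
    using assms unfolding fb_tableau_def by blast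
  show "has_left T i j \<or> has_above T i j" if "(i, j) \<in> T" "(i, j) \<noteq> (1, n)"
  proof -
    have "\<exists>d\<in>T. left_of d (i, j) \<or> above d (i, j)"
      using assms that unfolding fb_tableau_def root_def by blast
    then show ?thesis
      unfolding left_of_def above_def has_left_def has_above_def by auto
  qed
qed

lemma board_iff: "(i, j) \<in> board n \<longleftrightarrow> i = 1 \<and> 1 \<le> j \<and> j \<le> n \<or> 2 \<le> i \<and> i \<le> n \<and> i \<le> Suc j \<and> j \<le> n"
  unfolding board_def by auto

lemma board_cases:
  assumes "(i, j) \<in> board n"
  obtains "i = 1" "1 \<le> j" "j \<le> n" | "j = n" "2 \<le> i" "i \<le> n" | "in_triangle n i j"
  using assms unfolding board_iff in_triangle_def by (metis le_neq_implies_less)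

lemma in_triangle_board: "in_triangle n i j \<Longrightarrow> (i, j) \<in> board n"
  unfolding board_iff in_triangle_def by auto

lemma left_arrow_iff: "left_arrow n T (i, j) \<longleftrightarrow> (i, j) \<in> T \<and> (i, j) \<noteq> (1, n) \<and> \<not> has_left T i j"
  unfolding left_arrow_def left_of_def has_left_def root_def by auto

lemma up_arrow_iff: "up_arrow n T (i, j) \<longleftrightarrow> (i, j) \<in> T \<and> (i, j) \<noteq> (1, n) \<and> \<not> has_above T i j"
  unfolding up_arrow_def above_def has_above_def root_def by auto

lemma dot_iff:
  "dot n T (i, j) \<longleftrightarrow> (i, j) \<in> T \<and> ((i, j) = (1, n) \<or> has_left T i j \<and> has_above T i j)"
  unfolding dot_def left_arrow_iff up_arrow_iff by auto

lemma small_iff: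
  assumes "fb_tableau n T"
  shows "small n T \<longleftrightarrow> (\<forall>i j. (i, j) \<in> T \<longrightarrow> (i, j) \<noteq> (1, n) \<longrightarrow> \<not> (has_left T i j \<and> has_above T i j))"
  unfolding small_def set_eq_iff root_def using fb_tableauD(2)[OF assms] by (auto simp: dot_iff)

text \<open>The topmost nonempty cell of a column is an up-arrow; \<open>j < n\<close> keeps it from
  being the root.\<close>

lemma up_arrow_exists:
  assumes "fb_tableau n T" "j < n"
  shows "has_above T i j \<longleftrightarrow> (\<exists>i'<i. up_arrow n T (i', j))"
proof
  assume "has_above T i j"
  then obtain i' where i': "i' < i" "(i', j) \<in> T" unfolding has_above_def by blast
  define k where "k = (LEAST k. (k, j) \<in> T)"
  have "(k, j) \<in> T" using i' unfolding k_def by (metis LeastI)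
  moreover have "k \<le> i'" using i' unfolding k_def by (metis Least_le)
  moreover have "\<not> has_above T k j"
    unfolding has_above_def k_def using not_less_Least by blast
  ultimately show "\<exists>i'<i. up_arrow n T (i', j)"
    using assms(2) i'(1) unfolding up_arrow_iff by (intro exI[of _ k]) auto
qed (auto simp: up_arrow_iff has_above_def)

lemma left_arrow_exists:
  assumes "fb_tableau n T" "1 < i"
  shows "has_left T i j \<longleftrightarrow> (\<exists>j'>j. left_arrow n T (i, j'))"
proof
  assume "has_left T i j"
  then obtain j' where j': "j < j'" "(i, j') \<in> T" unfolding has_left_def by blast
  define K where "K = {k. (i, k) \<in> T}"
  have fin: "finite K"
  proof (rule finite_subset)
    show "K \<subseteq> {..n}"
      using fb_tableauD(1)[OF assms(1), of i] unfolding K_def by (auto simp: board_iff)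
  qed simp
  have mem: "j' \<in> K" using j' unfolding K_def by simp
  have "Max K \<in> K" "j' \<le> Max K" using fin mem by (auto intro: Max_in)
  moreover have "\<not> has_left T i (Max K)"
    unfolding has_left_def using fin Max_ge[of K] unfolding K_def by (metis mem_Collect_eq not_le)
  ultimately show "\<exists>j'>j. left_arrow n T (i, j')"
    using assms(2) j'(1) unfolding left_arrow_iff K_def by (intro exI[of _ "Max K"]) (auto simp: K_def)
qed (auto simp: left_arrow_iff has_left_def)

text \<open>Using row \<open>Suc i\<close> turns "weakly below an arrow" into "strictly below a
  nonempty cell".\<close>

lemma Col_iff:
  assumes "fb_tableau n T"
  shows "(i, j) \<in> Col n T \<longleftrightarrow> (i, j) \<in> board n \<and> (j = n \<or> has_above T (Suc i) j)"
proof -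
  have "(\<exists>d. (up_arrow n T d \<or> d = root n) \<and> (d = (i, j) \<or> above d (i, j))) \<longleftrightarrow>
      (j = n \<or> has_above T (Suc i) j)" if b: "(i, j) \<in> board n"
  proof (cases "j = n")
    case True
    then have "root n = (i, j) \<or> above (root n) (i, j)"
      using b unfolding root_def above_def board_iff by auto
    then show ?thesis using True by blast
  next
    case False
    then have "j < n" using b unfolding board_iff by auto
    then have "has_above T (Suc i) j \<longleftrightarrow> (\<exists>i'. i' \<le> i \<and> up_arrow n T (i', j))"
      using up_arrow_exists[OF assms] by (simp add: less_Suc_eq_le)
    also have "\<dots> \<longleftrightarrow> (\<exists>d. (up_arrow n T d \<or> d = root n) \<and> (d = (i, j) \<or> above d (i, j)))"
      using False unfolding root_def above_def by (auto simp: le_less)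
    finally show ?thesis using False by simp
  qed
  then show ?thesis unfolding Col_def by auto
qed

lemma Row_iff:
  assumes "fb_tableau n T"
  shows "(i, j) \<in> Row n T \<longleftrightarrow> (i, j) \<in> board n \<and> (i = 1 \<or> has_left T i j \<or> (i, j) \<in> T)"
proof -
  have "(\<exists>d. (left_arrow n T d \<or> d = root n) \<and> (d = (i, j) \<or> left_of d (i, j))) \<longleftrightarrow>
      (i = 1 \<or> has_left T i j \<or> (i, j) \<in> T)" if b: "(i, j) \<in> board n"
  proof (cases "i = 1")
    case True
    then have "root n = (i, j) \<or> left_of (root n) (i, j)"
      using b unfolding root_def left_of_def board_iff by auto
    then show ?thesis using True by blast
  next
    case False
    then have i: "1 < i" using b unfolding board_iff by auto
    have "(\<exists>d. (left_arrow n T d \<or> d = root n) \<and> (d = (i, j) \<or> left_of d (i, j))) \<longleftrightarrow>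
        left_arrow n T (i, j) \<or> (\<exists>j'>j. left_arrow n T (i, j'))"
      using False unfolding root_def left_of_def by auto
    also have "\<dots> \<longleftrightarrow> has_left T i j \<or> (i, j) \<in> T"
      using left_arrow_exists[OF assms i, of j] left_arrow_iff[of n T i j] False
      by (cases "has_left T i j") auto
    finally show ?thesis using False by simp
  qed
  then show ?thesis unfolding Row_def by auto
qed

lemma free_cell_iff:
  assumes "fb_tableau n T"
  shows "free_cell n T (i, j) \<longleftrightarrow> in_triangle n i j \<and> has_above T i j \<and> has_left T i j"
proof
  assume f: "free_cell n T (i, j)"
  then have b: "(i, j) \<in> board n" unfolding free_cell_def by blast
  obtain i' where i': "up_arrow n T (i', j)" "i' < i"
    using f unfolding free_cell_def above_def by auto
  obtain j' where j': "left_arrow n T (i, j')" "j < j'"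
    using f unfolding free_cell_def left_of_def by auto
  have "1 \<le> i'" using fb_tableauD(1)[OF assms] i' unfolding up_arrow_iff board_iff by force
  moreover have "j' \<le> n" using fb_tableauD(1)[OF assms] j' unfolding left_arrow_iff board_iff by force
  ultimately have "in_triangle n i j" using i' j' by (cases rule: board_cases[OF b]) auto
  then show "in_triangle n i j \<and> has_above T i j \<and> has_left T i j"
    using i' j' unfolding up_arrow_iff left_arrow_iff has_above_def has_left_def by blast
next
  assume *: "in_triangle n i j \<and> has_above T i j \<and> has_left T i j"
  then have "1 < i" "j < n" unfolding in_triangle_def by auto
  then obtain i' j' where "i' < i" "up_arrow n T (i', j)" "j' > j" "left_arrow n T (i, j')"
    using * up_arrow_exists[OF assms, of j i] left_arrow_exists[OF assms, of i j] by blast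
  then show "free_cell n T (i, j)"
    using * in_triangle_board unfolding free_cell_def above_def left_of_def by force
qed

lemma tableau_le_iff:
  assumes S: "fb_tableau n S" and T: "fb_tableau n T"
  shows "tableau_le n S T \<longleftrightarrow> (\<forall>i j. in_triangle n i j \<longrightarrow>
    (has_above S i j \<longrightarrow> has_above T i j) \<and> (has_left T i j \<longrightarrow> has_left S i j) \<and>
    (has_above S i j \<and> has_left S i j \<and> has_above T i j \<and> has_left T i j \<and> (i, j) \<in> S \<longrightarrow> (i, j) \<in> T))"
proof -
  have col: "Col n S \<subseteq> Col n T \<longleftrightarrow> (\<forall>i j. in_triangle n i j \<longrightarrow> has_above S i j \<longrightarrow> has_above T i j)"
  proof (intro iffI allI impI)
    fix i j assume *: "Col n S \<subseteq> Col n T" "in_triangle n i j" "has_above S i j"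
    then have "(i - 1, j) \<in> board n" "Suc (i - 1) = i" "j \<noteq> n"
      unfolding in_triangle_def board_iff by auto
    then show "has_above T i j" using * Col_iff[OF S, of "i - 1" j] Col_iff[OF T, of "i - 1" j] by auto
  next
    assume *: "\<forall>i j. in_triangle n i j \<longrightarrow> has_above S i j \<longrightarrow> has_above T i j"
    show "Col n S \<subseteq> Col n T"
    proof (rule subrelI)
      fix i j assume "(i, j) \<in> Col n S"
      then have b: "(i, j) \<in> board n" and h: "j = n \<or> has_above S (Suc i) j"
        using Col_iff[OF S] by auto
      have "has_above T (Suc i) j" if "j \<noteq> n"
      \<comment> \<open>At the border the next row has left the triangle, but the border cell itself
        is nonempty in every tableau.\<close>
      proof (cases "i = Suc j")
        case True
        then have "(i, j) \<in> T" using b that fb_tableauD(3)[OF T, of j] unfolding board_iff by auto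
        then show ?thesis by (simp add: has_above_Suc)
      next
        case False
        then have "in_triangle n (Suc i) j" using b that unfolding board_iff in_triangle_def by auto
        then show ?thesis using * h that by blast
      qed
      then show "(i, j) \<in> Col n T" using b Col_iff[OF T] by auto
    qed
  qed
  have row: "Row n T \<subseteq> Row n S \<longleftrightarrow> (\<forall>i j. in_triangle n i j \<longrightarrow> has_left T i j \<longrightarrow> has_left S i j)"
  proof (intro iffI allI impI)
    fix i j assume *: "Row n T \<subseteq> Row n S" "in_triangle n i j" "has_left T i j"
    then have "(i, Suc j) \<in> board n" "i \<noteq> 1"
      unfolding in_triangle_def board_iff by auto
    then show "has_left S i j"
      using * Row_iff[OF S, of i "Suc j"] Row_iff[OF T, of i "Suc j"] by (auto simp: has_left_Suc[of _ i j])
  next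
    assume *: "\<forall>i j. in_triangle n i j \<longrightarrow> has_left T i j \<longrightarrow> has_left S i j"
    show "Row n T \<subseteq> Row n S"
    proof (rule subrelI)
      fix i j assume "(i, j) \<in> Row n T"
      then have b: "(i, j) \<in> board n" and h: "i = 1 \<or> has_left T i j \<or> (i, j) \<in> T"
        using Row_iff[OF T] by auto
      have "has_left S i j \<or> (i, j) \<in> S" if "i \<noteq> 1"
      proof (cases "i = Suc j")
        case True
        then show ?thesis using b that fb_tableauD(3)[OF S, of j] unfolding board_iff by auto
      next
        case False
        then have "in_triangle n i (j - 1)" "Suc (j - 1) = j"
          using b that unfolding board_iff in_triangle_def by auto
        then show ?thesis using * h that has_left_Suc[of T i "j - 1"] has_left_Suc[of S i "j - 1"] by auto
      qed
      then show "(i, j) \<in> Row n S" using b Row_iff[OF S] by auto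
    qed
  qed
  have "(\<forall>c. free_cell n S c \<and> free_cell n T c \<and> dot n S c \<longrightarrow> dot n T c) \<longleftrightarrow>
    (\<forall>i j. in_triangle n i j \<longrightarrow> has_above S i j \<and> has_left S i j \<and> has_above T i j \<and> has_left T i j \<and>
       (i, j) \<in> S \<longrightarrow> (i, j) \<in> T)"
  proof (intro iffI allI impI)
    fix i j
    assume *: "\<forall>c. free_cell n S c \<and> free_cell n T c \<and> dot n S c \<longrightarrow> dot n T c" "in_triangle n i j"
      "has_above S i j \<and> has_left S i j \<and> has_above T i j \<and> has_left T i j \<and> (i, j) \<in> S"
    then have "dot n T (i, j)"
      using free_cell_iff[OF S, of i j] free_cell_iff[OF T, of i j] dot_iff[of n S i j] by blast
    then show "(i, j) \<in> T" using dot_iff by blast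
  next
    fix c
    assume *: "\<forall>i j. in_triangle n i j \<longrightarrow> has_above S i j \<and> has_left S i j \<and> has_above T i j \<and>
        has_left T i j \<and> (i, j) \<in> S \<longrightarrow> (i, j) \<in> T"
      "free_cell n S c \<and> free_cell n T c \<and> dot n S c"
    obtain i j where c: "c = (i, j)" by (cases c)
    show "dot n T c"
      using * free_cell_iff[OF S, of i j] free_cell_iff[OF T, of i j] dot_iff[of n S i j] dot_iff[of n T i j]
      unfolding c by blast
  qed
  then show ?thesis unfolding tableau_le_def col row by blast
qed

lemma items_in_triangle: "(i, j, t) \<in> items b n \<Longrightarrow> in_triangle n i j"
  unfolding items_def in_triangle_def by auto

lemma lowest_in_items: "in_triangle n i j \<Longrightarrow> (i, j, lowest b i j) \<in> items b n"
  unfolding items_def in_triangle_def lowest_def by auto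

lemma top_in_items: "in_triangle n i j \<Longrightarrow> (i, j, 3) \<in> items b n"
  unfolding items_def in_triangle_def by auto

lemma code_iff: "(i, j, t) \<in> code b n T \<longleftrightarrow> (i, j, t) \<in> items b n \<and> has_above T i j \<and>
     (t = 3 \<longrightarrow> \<not> has_left T i j) \<and> (t = 2 \<longrightarrow> \<not> has_left T i j \<or> (i, j) \<in> T)"
  unfolding code_def by simp

lemma tableauxD:
  assumes "T \<in> tableaux b n"
  shows "fb_tableau n T"
    "\<not> b \<Longrightarrow> (i, j) \<in> T \<Longrightarrow> (i, j) \<noteq> (1, n) \<Longrightarrow> \<not> (has_left T i j \<and> has_above T i j)"
  using assms small_iff unfolding tableaux_def by auto

text \<open>The case needing care is item 3 as lowest item: a border cell of a small tableau. It is
  nonempty and no dot, so a nonempty cell above excludes one to the left.\<close>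

lemma code_lowest_iff:
  assumes T: "T \<in> tableaux b n" and tri: "in_triangle n i j"
  shows "(i, j, lowest b i j) \<in> code b n T \<longleftrightarrow> has_above T i j"
proof -
  have "\<not> has_left T i j" if "lowest b i j = 3" "has_above T i j"
  proof -
    have "\<not> b" "i = Suc j" "1 \<le> j" "j < n"
      using that(1) tri unfolding lowest_def in_triangle_def by (auto split: if_splits)
    moreover have "(Suc j, j) \<in> T"
      using fb_tableauD(3)[OF tableauxD(1)[OF T]] calculation by blast
    ultimately show ?thesis using tableauxD(2)[OF T, of i j] that(2) by auto
  qed
  moreover have "lowest b i j \<noteq> 2" unfolding lowest_def by auto
  ultimately show ?thesis using lowest_in_items[OF tri, of b] unfolding code_iff by auto
qed

lemma code_top_iff:
  assumes "in_triangle n i j"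
  shows "(i, j, 3) \<in> code b n T \<longleftrightarrow> has_above T i j \<and> \<not> has_left T i j"
  using top_in_items[OF assms] unfolding code_iff by auto

text \<open>If nothing lies to the left of \<open>(i, j)\<close>, the left-arrow of row
  \<open>i\<close> is at a label \<open>k \<le> j\<close>. Not having a cell to its left, it must
  have one above, so its height is 3.\<close>

lemma has_left_iff_code:
  assumes T: "fb_tableau n T" and tri: "in_triangle n i j"
  shows "has_left T i j \<longleftrightarrow> \<not> (\<exists>k\<le>j. (i, k, 3) \<in> code b n T)"
proof
  assume l: "has_left T i j"
  show "\<not> (\<exists>k\<le>j. (i, k, 3) \<in> code b n T)"
  proof
    assume "\<exists>k\<le>j. (i, k, 3) \<in> code b n T"
    then obtain k where "k \<le> j" "\<not> has_left T i k" unfolding code_iff by auto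
    then show False using has_left_mono[OF l] by blast
  qed
next
  assume n: "\<not> (\<exists>k\<le>j. (i, k, 3) \<in> code b n T)"
  show "has_left T i j"
  proof (rule ccontr)
    assume l: "\<not> has_left T i j"
    have i: "2 \<le> i" "i \<le> Suc j" "j < n" using tri unfolding in_triangle_def by auto
    \<comment> \<open>The border cell shows that row \<open>i\<close> is not empty; starting the
      search for the left-arrow from label \<open>i - 2\<close> keeps it on the board.\<close>
    have "(Suc (i - 1), i - 1) \<in> T" using i by (intro fb_tableauD(3)[OF T]) auto
    then have "has_left T i (i - 2)"
      using i unfolding has_left_def by (intro exI[of _ "i - 1"]) auto
    then obtain k where k: "left_arrow n T (i, k)" "i - 2 < k"
      using left_arrow_exists[OF T, of i "i - 2"] i by auto
    have kj: "k \<le> j"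
      using k(1) l unfolding left_arrow_iff has_left_def by (meson not_le)
    then have tri': "in_triangle n i k" using k(2) i unfolding in_triangle_def by auto
    have "has_above T i k"
      using fb_tableauD(4)[OF T, of i k] k(1) unfolding left_arrow_iff by blast
    then have "(i, k, 3) \<in> code b n T"
      using code_top_iff[OF tri'] k(1) unfolding left_arrow_iff by blast
    then show False using n kj by blast
  qed
qed

lemma code_closed:
  assumes T: "T \<in> tableaux b n"
  shows "item_closed b n (code b n T)"
  unfolding item_closed_def
proof (intro conjI allI impI)
  show "code b n T \<subseteq> items b n" unfolding code_def by auto
next
  fix i j s t assume *: "(i, j, t) \<in> code b n T \<and> (i, j, s) \<in> items b n \<and> s \<le> t"
  then show "(i, j, s) \<in> code b n T"
    using top_item[of i j t b n] unfolding code_iff by auto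
next
  fix i j t assume *: "(i, j, t) \<in> code b n T \<and> i \<le> j"
  then have "in_triangle n i j" "has_above T i j"
    using items_in_triangle unfolding code_iff by blast+
  then have "in_triangle n (Suc i) j" "has_above T (Suc i) j"
    using * has_above_Suc unfolding in_triangle_def by auto
  then show "(Suc i, j, lowest b (Suc i) j) \<in> code b n T"
    using code_lowest_iff[OF T] by blast
next
  fix i j k t
  assume *: "(i, k, 3) \<in> code b n T \<and> k < j \<and> (Suc i, j, lowest b (Suc i) j) \<in> code b n T \<and>
    (i, j, t) \<in> items b n"
  then have ab: "has_above T (Suc i) j" and l: "\<not> has_left T i k" unfolding code_iff by auto
  then have "\<not> has_left T i j" "(i, j) \<notin> T"
    using * has_left_mono[of T i j k] unfolding has_left_def by auto
  then show "(i, j, t) \<in> code b n T"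
    using ab * has_above_Suc[of T i j] unfolding code_iff by auto
qed

lemma code_subset_iff:
  assumes S: "S \<in> tableaux b n" and T: "T \<in> tableaux b n"
  shows "tableau_le n S T \<longleftrightarrow> code b n S \<subseteq> code b n T"
proof
  assume le: "tableau_le n S T"
  show "code b n S \<subseteq> code b n T"
  proof
    fix x assume x: "x \<in> code b n S"
    obtain i j t where ijt: "x = (i, j, t)" by (cases x)
    have tri: "in_triangle n i j" using x items_in_triangle unfolding ijt code_iff by blast
    show "x \<in> code b n T"
      using x le tri unfolding ijt code_iff tableau_le_iff[OF tableauxD(1)[OF S] tableauxD(1)[OF T]]
      by blast
  qed
next
  assume sub: "code b n S \<subseteq> code b n T"
  show "tableau_le n S T"
    unfolding tableau_le_iff[OF tableauxD(1)[OF S] tableauxD(1)[OF T]]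
  proof (intro allI impI conjI)
    fix i j assume tri: "in_triangle n i j"
    show "has_above S i j \<Longrightarrow> has_above T i j"
      using sub code_lowest_iff[OF S tri] code_lowest_iff[OF T tri] by blast
    show "has_left T i j \<Longrightarrow> has_left S i j"
      using sub has_left_iff_code[OF tableauxD(1)[OF S] tri, of b]
        has_left_iff_code[OF tableauxD(1)[OF T] tri, of b] by blast
    assume *: "has_above S i j \<and> has_left S i j \<and> has_above T i j \<and> has_left T i j \<and> (i, j) \<in> S"
    show "(i, j) \<in> T"
    proof (cases "i = Suc j")
      case True
      then show ?thesis using fb_tableauD(3)[OF tableauxD(1)[OF T], of j] tri
        unfolding in_triangle_def by auto
    next
      case False
      have "(i, j) \<noteq> (1, n)" using tri unfolding in_triangle_def by auto
      \<comment> \<open>A nonempty free cell is a dot other than the root, impossible in a small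
        tableau; hence item 2 is available.\<close>
      then have b using tableauxD(2)[OF S, of i j] * by blast
      then have "(i, j, 2) \<in> items b n" using False tri unfolding items_def in_triangle_def by auto
      then have "(i, j, 2) \<in> code b n S" using * unfolding code_iff by auto
      then have "(i, j, 2) \<in> code b n T" using sub by blast
      then show ?thesis using * unfolding code_iff by simp
    qed
  qed
qed

text \<open>A cell with nothing above is nonempty iff the next cell down has something above;
  likewise with left and the next cell to the right. At the border, where there is no next cell,
  both tableaux are nonempty. Only free cells need the third condition.\<close>

lemma fb_tableau_eqI:
  assumes S: "fb_tableau n S" and T: "fb_tableau n T"
    and eq: "\<And>i j. in_triangle n i j \<Longrightarrow> has_above S i j = has_above T i j"
      "\<And>i j. in_triangle n i j \<Longrightarrow> has_left S i j = has_left T i j"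
      "\<And>i j. in_triangle n i j \<Longrightarrow> has_above S i j \<Longrightarrow> has_left S i j \<Longrightarrow> (i, j) \<in> S \<longleftrightarrow> (i, j) \<in> T"
  shows "S = T"
proof (rule Set.set_eqI, unfold split_paired_all)
  fix i j
  have above: "(i, j) \<in> S \<longleftrightarrow> (i, j) \<in> T"
    if b: "(i, j) \<in> board n" "j \<noteq> n" "\<not> has_above S i j" "\<not> has_above T i j"
  proof (cases "i = Suc j")
    case True
    then show ?thesis
      using b fb_tableauD(3)[OF S, of j] fb_tableauD(3)[OF T, of j] unfolding board_iff by auto
  next
    case False
    then have "in_triangle n (Suc i) j" using b unfolding board_iff in_triangle_def by auto
    then show ?thesis using b eq(1)[of "Suc i" j] by (simp add: has_above_Suc)
  qed
  have left: "(i, j) \<in> S \<longleftrightarrow> (i, j) \<in> T"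
    if b: "(i, j) \<in> board n" "i \<noteq> 1" "\<not> has_left S i j" "\<not> has_left T i j"
  proof (cases "i = Suc j")
    case True
    then show ?thesis
      using b fb_tableauD(3)[OF S, of j] fb_tableauD(3)[OF T, of j] unfolding board_iff by auto
  next
    case False
    then have "in_triangle n i (j - 1)" "Suc (j - 1) = j" using b unfolding board_iff in_triangle_def by auto
    then show ?thesis
      using b eq(2)[of i "j - 1"] has_left_Suc[of S i "j - 1"] has_left_Suc[of T i "j - 1"] by simp
  qed
  have no: "\<not> has_above U 1 j" "\<not> has_left U i n" if "fb_tableau n U" for U
    using fb_tableauD(1)[OF that] unfolding has_above_def has_left_def board_iff by fastforce+
  have "(i, j) \<in> S \<longleftrightarrow> (i, j) \<in> T" if b: "(i, j) \<in> board n"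
  proof (cases rule: board_cases[OF b])
    case 1
    then show ?thesis using above b no[OF S] no[OF T] fb_tableauD(2)[OF S] fb_tableauD(2)[OF T] by auto
  next
    case 2
    then show ?thesis using left b no[OF S] no[OF T] by auto
  next
    case 3
    then have "j \<noteq> n" "i \<noteq> 1" unfolding in_triangle_def by auto
    then show ?thesis using above left b eq[OF 3] by blast
  qed
  then show "(i, j) \<in> S \<longleftrightarrow> (i, j) \<in> T"
    using fb_tableauD(1)[OF S, of i j] fb_tableauD(1)[OF T, of i j] by blast
qed

lemma tableau_le_antisym:
  assumes "fb_tableau n S" "fb_tableau n T" "tableau_le n S T" "tableau_le n T S"
  shows "S = T"
  using assms unfolding tableau_le_iff[OF assms(1,2)] tableau_le_iff[OF assms(2,1)]
  by (intro fb_tableau_eqI) blast+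

section \<open>Reconstruction of a tableau from a closed set of items\<close>

definition up_mark :: "bool \<Rightarrow> item set \<Rightarrow> nat \<Rightarrow> nat \<Rightarrow> bool" where
  "up_mark b X i j \<longleftrightarrow> (i, j, lowest b i j) \<in> X"

text \<open>Meant to say that nothing lies to the left of \<open>(i, j)\<close>, as in
  \<open>has_left_iff_code\<close>.\<close>

definition left_mark :: "item set \<Rightarrow> nat \<Rightarrow> nat \<Rightarrow> bool" where
  "left_mark X i j \<longleftrightarrow> (\<exists>k\<le>j. (i, k, 3) \<in> X)"

text \<open>Inside the triangle the three alternatives are the dots, the left-arrows (the smallest
  label of the row carrying item 3) and the up-arrows (where the upper mark of the column first
  appears one row further down). Arrows outside the triangle lie in row 1 or in column
  \<open>n\<close>.\<close>

definition decode :: "bool \<Rightarrow> nat \<Rightarrow> item set \<Rightarrow> cell set" where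
  "decode b n X = {(1, n)} \<union> {(1, j) |j. 1 \<le> j \<and> j < n \<and> up_mark b X 2 j} \<union>
     {(i, n) |i. 2 \<le> i \<and> i \<le> n \<and> \<not> left_mark X i (n - 1)} \<union>
     {(i, j). in_triangle n i j \<and>
        (up_mark b X i j \<and> \<not> left_mark X i j \<and> (i = Suc j \<or> (i, j, 2) \<in> X) \<or>
         (i, j, 3) \<in> X \<and> (\<forall>k<j. (i, k, 3) \<notin> X) \<or>
         \<not> up_mark b X i j \<and> \<not> left_mark X i j \<and> (i = Suc j \<or> up_mark b X (Suc i) j))}"

lemma decode_row1: "j < n \<Longrightarrow> (Suc 0, j) \<in> decode b n X \<longleftrightarrow> 1 \<le> j \<and> up_mark b X 2 j"
  unfolding decode_def in_triangle_def by auto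

lemma decode_column: "2 \<le> i \<Longrightarrow> (i, n) \<in> decode b n X \<longleftrightarrow> i \<le> n \<and> \<not> left_mark X i (n - 1)"
  unfolding decode_def in_triangle_def by auto

lemma decode_triangle:
  assumes "in_triangle n i j"
  shows "(i, j) \<in> decode b n X \<longleftrightarrow>
        (up_mark b X i j \<and> \<not> left_mark X i j \<and> (i = Suc j \<or> (i, j, 2) \<in> X) \<or>
         (i, j, 3) \<in> X \<and> (\<forall>k<j. (i, k, 3) \<notin> X) \<or>
         \<not> up_mark b X i j \<and> \<not> left_mark X i j \<and> (i = Suc j \<or> up_mark b X (Suc i) j))"
  using assms unfolding decode_def in_triangle_def by auto

lemma decode_board: "1 \<le> n \<Longrightarrow> (i, j) \<in> decode b n X \<Longrightarrow> (i, j) \<in> board n"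
  unfolding decode_def board_iff in_triangle_def by auto

lemma top_up_mark: "item_closed b n X \<Longrightarrow> (i, j, 3) \<in> X \<Longrightarrow> up_mark b X i j"
  unfolding up_mark_def by (rule item_closed_lowest)

text \<open>By the two-column closure rule, a cell that would have to be nonempty with nothing to
  its left has something above. This keeps the reconstructed cells supported.\<close>

lemma left_up_mark:
  assumes X: "item_closed b n X" and tri: "in_triangle n i j"
    and l: "left_mark X i j" and u: "i = Suc j \<or> up_mark b X (Suc i) j"
  shows "up_mark b X i j \<and> (i, j, 3) \<in> X"
proof -
  obtain k where k: "k \<le> j" "(i, k, 3) \<in> X" using l unfolding left_mark_def by blast
  have "(i, j, 3) \<in> X"
  proof (cases "k = j")
    case False
    then have "i \<le> j"
      using k item_closedD(1)[OF X] items_in_triangle[of i k 3 b n] unfolding in_triangle_def by auto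
    then show ?thesis
      using item_closedD(4)[OF X k(2)] False k(1) u top_in_items[OF tri] unfolding up_mark_def by simp
  qed (use k in simp)
  then show ?thesis using top_up_mark[OF X] by blast
qed

lemma up_mark_mono:
  assumes X: "item_closed b n X" and "up_mark b X i j" "i \<le> i'" "i' \<le> Suc j"
  shows "up_mark b X i' j"
  using item_closed_column[OF X] assms(2-4) unfolding up_mark_def by blast

lemma left_mark_mono: "left_mark X i j \<Longrightarrow> j \<le> j' \<Longrightarrow> left_mark X i j'"
  unfolding left_mark_def by (meson le_trans)

lemma has_above_decode:
  assumes X: "item_closed b n X" and tri: "in_triangle n i j"
  shows "has_above (decode b n X) i j \<longleftrightarrow> up_mark b X i j"
proof
  assume "has_above (decode b n X) i j"
  then obtain i' where i': "i' < i" "(i', j) \<in> decode b n X" unfolding has_above_def by blast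
  have ij: "2 \<le> i" "i \<le> Suc j" "j < n" using tri unfolding in_triangle_def by auto
  have b: "(i', j) \<in> board n" using decode_board[OF _ i'(2)] ij by auto
  show "up_mark b X i j"
  proof (cases rule: board_cases[OF b])
    case 1
    then show ?thesis
      using i' ij decode_row1[of j n b X] up_mark_mono[OF X, of 2 j i] by auto
  next
    case 2
    then show ?thesis using ij by simp
  next
    case 3
    have "up_mark b X i' j \<or> up_mark b X (Suc i') j"
      using i' ij top_up_mark[OF X, of i' j] unfolding decode_triangle[OF 3] by auto
    then show ?thesis
      using up_mark_mono[OF X, of i' j i] up_mark_mono[OF X, of "Suc i'" j i] i' ij by auto
  qed
next
  assume u: "up_mark b X i j"
  have ij: "2 \<le> i" "i \<le> Suc j" "j < n" using tri unfolding in_triangle_def by auto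
  \<comment> \<open>The up-arrow of column \<open>j\<close> sits directly above the first marked
    row: in row 1 if \<open>m = 2\<close>, otherwise at \<open>(m - 1, j)\<close>.\<close>
  define m where "m = (LEAST m. 2 \<le> m \<and> up_mark b X m j)"
  have m: "2 \<le> m" "up_mark b X m j" "m \<le> i"
    using LeastI[of "\<lambda>m. 2 \<le> m \<and> up_mark b X m j" i] Least_le[of "\<lambda>m. 2 \<le> m \<and> up_mark b X m j" i]
      u ij(1) unfolding m_def by auto
  show "has_above (decode b n X) i j"
  proof (cases "m = 2")
    case True
    then have "(1, j) \<in> decode b n X" using m ij decode_row1[of j n b X] by auto
    then show ?thesis using ij unfolding has_above_def by (intro exI[of _ 1]) auto
  next
    case False
    define k where "k = m - 1"
    have k: "2 \<le> k" "m = Suc k" using False m unfolding k_def by auto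
    have nu: "\<not> up_mark b X k j"
      using not_less_Least[of k "\<lambda>m. 2 \<le> m \<and> up_mark b X m j"] k unfolding m_def[symmetric] by auto
    have tri': "in_triangle n k j" using k m ij unfolding in_triangle_def by auto
    have "\<not> left_mark X k j" using left_up_mark[OF X tri'] nu m k by blast
    then have "(k, j) \<in> decode b n X"
      using nu m k unfolding decode_triangle[OF tri'] by blast
    then show ?thesis using k m unfolding has_above_def by (intro exI[of _ k]) auto
  qed
qed

lemma has_left_decode:
  assumes X: "item_closed b n X" and tri: "in_triangle n i j"
  shows "has_left (decode b n X) i j \<longleftrightarrow> \<not> left_mark X i j"
proof
  have ij: "2 \<le> i" "i \<le> Suc j" "j < n" using tri unfolding in_triangle_def by auto
  assume "has_left (decode b n X) i j"
  then obtain j' where j': "j < j'" "(i, j') \<in> decode b n X" unfolding has_left_def by blast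
  have b: "(i, j') \<in> board n" using decode_board[OF _ j'(2)] ij by auto
  show "\<not> left_mark X i j"
  proof (cases rule: board_cases[OF b])
    case 1
    then show ?thesis using ij by simp
  next
    case 2
    then have "\<not> left_mark X i (n - 1)" "j \<le> n - 1" using j' ij decode_column[of i n b X] by auto
    then show ?thesis using left_mark_mono by blast
  next
    case 3
    have "\<not> left_mark X i j' \<or> (\<forall>k<j'. (i, k, 3) \<notin> X)"
      using j' unfolding decode_triangle[OF 3] by blast
    then show ?thesis using left_mark_mono[of X i j j'] j'(1) unfolding left_mark_def by auto
  qed
next
  have ij: "2 \<le> i" "i \<le> Suc j" "j < n" using tri unfolding in_triangle_def by auto
  assume l: "\<not> left_mark X i j"
  show "has_left (decode b n X) i j"
  proof (cases "left_mark X i (n - 1)")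
    case False
    then have "(i, n) \<in> decode b n X" using ij decode_column[of i n b X] by auto
    then show ?thesis using ij unfolding has_left_def by blast
  next
    case True
    \<comment> \<open>This is the left-arrow of row \<open>i\<close>; since the mark at
      \<open>j\<close> is absent, it lies strictly to the left of \<open>j\<close>.\<close>
    define k where "k = (LEAST k. (i, k, 3) \<in> X)"
    have k: "(i, k, 3) \<in> X" "k \<le> n - 1"
      using True unfolding left_mark_def k_def by (auto intro: LeastI Least_le order_trans)
    have least: "\<forall>k'<k. (i, k', 3) \<notin> X" unfolding k_def using not_less_Least by blast
    have kj: "j < k" using l k(1) unfolding left_mark_def by (meson not_le)
    have "in_triangle n i k" using ij kj k(2) unfolding in_triangle_def by auto
    then have "(i, k) \<in> decode b n X" using k least by (simp add: decode_triangle)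
    then show ?thesis using kj unfolding has_left_def by blast
  qed
qed

lemma decode_fb:
  assumes n: "1 \<le> n" and X: "item_closed b n X"
  shows "fb_tableau n (decode b n X)"
proof -
  have ha: "\<exists>d\<in>decode b n X. left_of d (i, j) \<or> above d (i, j)"
    if "has_left (decode b n X) i j \<or> has_above (decode b n X) i j" for i j
    using that unfolding has_left_def has_above_def left_of_def above_def by force
  have border: "(Suc j, j) \<in> decode b n X" if "1 \<le> j" "j < n" for j
  proof -
    have tri: "in_triangle n (Suc j) j" using that unfolding in_triangle_def by auto
    have "k < j \<Longrightarrow> (Suc j, k, 3) \<notin> X" for k
      using item_closedD(1)[OF X] items_in_triangle[of "Suc j" k 3 b n] unfolding in_triangle_def by auto
    then show ?thesis
      using left_up_mark[OF X tri] unfolding decode_triangle[OF tri] by blast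
  qed
  have root: "(1, n) \<in> decode b n X" unfolding decode_def by auto
  have arrow: "has_left (decode b n X) i j \<or> has_above (decode b n X) i j"
    if mem: "(i, j) \<in> decode b n X" "(i, j) \<noteq> (1, n)" for i j
  proof (cases rule: board_cases[OF decode_board[OF n mem(1)]])
    case 1
    then have "j < n" using mem by auto
    then show ?thesis using 1 root unfolding has_left_def by auto
  next
    case 2
    then show ?thesis using root unfolding has_above_def by (metis One_nat_def Suc_1 Suc_le_lessD)
  next
    case 3
    then show ?thesis
      using mem(1) top_up_mark[OF X, of i j]
      unfolding has_left_decode[OF X 3] has_above_decode[OF X 3] decode_triangle[OF 3] by blast
  qed
  show ?thesis
    unfolding fb_tableau_def
  proof (intro conjI ballI impI subsetI)
    fix c assume "c \<in> decode b n X" then show "c \<in> board n" using decode_board[OF n] by (cases c) auto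
  next
    show "root n \<in> decode b n X" using root unfolding root_def .
  next
    fix c assume "c \<in> border n"
    then obtain i where "c = (i, i - 1)" "2 \<le> i" "i \<le> n" unfolding border_def by blast
    then show "c \<in> decode b n X" using border[of "i - 1"] by simp
  next
    fix c assume "c \<in> decode b n X" "c \<noteq> root n"
    then show "\<exists>d\<in>decode b n X. left_of d c \<or> above d c"
      using arrow ha unfolding root_def by (cases c) blast
  qed
qed

lemma decode_tableaux:
  assumes n: "1 \<le> n" and X: "item_closed b n X"
  shows "decode b n X \<in> tableaux b n"
proof -
  have "small n (decode b n X)" if nb: "\<not> b"
    unfolding small_iff[OF decode_fb[OF n X]]
  proof (intro allI impI notI)
    fix i j
    assume mem: "(i, j) \<in> decode b n X" "(i, j) \<noteq> (1, n)"
      and lr: "has_left (decode b n X) i j \<and> has_above (decode b n X) i j"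
    have no: "\<not> has_above (decode b n X) 1 j" "\<not> has_left (decode b n X) i n"
      using fb_tableauD(1)[OF decode_fb[OF n X]] unfolding has_above_def has_left_def board_iff
      by fastforce+
    show False
    proof (cases rule: board_cases[OF decode_board[OF n mem(1)]])
      case 3
      then have *: "\<not> left_mark X i j" "up_mark b X i j"
        using lr has_left_decode[OF X 3] has_above_decode[OF X 3] by auto
      have "(i, j, 3) \<notin> X" using *(1) unfolding left_mark_def by blast
      then have "i = Suc j \<or> (i, j, 2) \<in> X"
        using mem(1) * unfolding decode_triangle[OF 3] by blast
      moreover have "(i, j, 2) \<notin> X" using item_closedD(1)[OF X] nb unfolding items_def by auto
      ultimately have "i = Suc j" by blast
      then have "lowest b i j = 3" using nb unfolding lowest_def by auto
      then show False using * unfolding up_mark_def left_mark_def by auto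
    qed (use lr no in auto)
  qed
  then show ?thesis using decode_fb[OF n X] unfolding tableaux_def by blast
qed

lemma code_decode:
  assumes n: "1 \<le> n" and X: "item_closed b n X"
  shows "code b n (decode b n X) = X"
proof (rule Set.set_eqI, unfold split_paired_all)
  fix i j t
  show "(i, j, t) \<in> code b n (decode b n X) \<longleftrightarrow> (i, j, t) \<in> X"
  proof (cases "(i, j, t) \<in> items b n")
    case False
    then show ?thesis using item_closedD(1)[OF X] unfolding code_iff by blast
  next
    case True
    then have tri: "in_triangle n i j" by (rule items_in_triangle)
    have low: "(i, j, t) \<in> X \<Longrightarrow> up_mark b X i j"
      unfolding up_mark_def by (rule item_closed_lowest[OF X])
    have top: "(i, j, 3) \<in> X" if "left_mark X i j" "up_mark b X i j"
    proof -
      have "i = Suc j \<or> up_mark b X (Suc i) j"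
        using up_mark_mono[OF X that(2), of "Suc i"] tri unfolding in_triangle_def
        by (cases "i = Suc j") auto
      then show ?thesis using left_up_mark[OF X tri that(1)] by blast
    qed
    have left: "(i, j, 3) \<in> X \<Longrightarrow> left_mark X i j" unfolding left_mark_def by blast
    have t3: "(i, j, 3) \<in> X \<Longrightarrow> (i, j, t) \<in> X"
      using item_closedD(2)[OF X _ True] top_item[OF True] by blast
    consider "t = 1" "lowest b i j = 1" | "t = 2" "i \<le> j" | "t = 3"
      using True unfolding items_def lowest_def by auto
    then show ?thesis
    proof cases
      case 1
      then show ?thesis
        using True unfolding code_iff has_above_decode[OF X tri] up_mark_def by simp
    next
      case 2
      then show ?thesis
        using True low top left t3
        unfolding code_iff has_above_decode[OF X tri] has_left_decode[OF X tri] decode_triangle[OF tri]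
        by auto
    next
      case 3
      then show ?thesis
        using True low top left
        unfolding code_iff has_above_decode[OF X tri] has_left_decode[OF X tri] by auto
    qed
  qed
qed

lemma card_tableau_congruences:
  assumes n: "1 \<le> n"
    and L: "L = \<lparr>carrier = tableaux b n, eq = (=), le = tableau_le n\<rparr>"
  shows "card (carrier (congruence_lattice L)) = card {I. forcing_closed b (items b n) I}"
proof -
  interpret closure_system "items b n" "Collect (item_closed b n)"
    by (rule closure_system_items)
  have "card (carrier (congruence_lattice L)) = card {\<theta>. set_congruence \<theta>}"
  proof (rule card_congruences)
    show "bij_betw (code b n) (carrier L) (Collect (item_closed b n))"
    proof (rule bij_betwI[where g = "decode b n"])
      show "decode b n (code b n T) = T" if T: "T \<in> carrier L" for T
      proof -
        have T': "T \<in> tableaux b n" using T L by simp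
        let ?D = "decode b n (code b n T)"
        have D: "?D \<in> tableaux b n" by (rule decode_tableaux[OF n code_closed[OF T']])
        \<comment> \<open>\<open>decode\<close> after \<open>code\<close> is not computed: equal
          codes give both inequalities, and antisymmetry gives equality.\<close>
        have "code b n ?D = code b n T" by (rule code_decode[OF n code_closed[OF T']])
        then have "tableau_le n ?D T" "tableau_le n T ?D"
          using code_subset_iff[OF D T'] code_subset_iff[OF T' D] by auto
        then show ?thesis using tableau_le_antisym tableauxD(1)[OF D] tableauxD(1)[OF T'] by blast
      qed
    qed (use L n in \<open>auto simp: code_closed decode_tableaux code_decode\<close>)
  qed (use L code_subset_iff in auto)
  then show ?thesis using card_congruences_eq_ideals by simp
qed

lemma num_cong_0: "num_cong_sTam 0 = 1" "num_cong_esTam 0 = 1"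
  unfolding num_cong_sTam_def num_cong_esTam_def by simp_all

lemma num_cong_esTam_ideals:
  "1 \<le> n \<Longrightarrow> num_cong_esTam n = card {I. forcing_closed True (items True n) I}"
  unfolding num_cong_esTam_def
  by (simp add: card_tableau_congruences esTam_def tableaux_def)

lemma num_cong_sTam_ideals:
  "1 \<le> n \<Longrightarrow> num_cong_sTam n = card {I. forcing_closed False (items False n) I}"
  unfolding num_cong_sTam_def
  by (simp add: card_tableau_congruences sTam_def tableaux_def)

section \<open>Continued fractions as generating functions of weighted paths\<close>

text \<open>Total weight of the paths from height \<open>h\<close> to 0 with \<open>m\<close> up and
  level steps together: a down step from \<open>i\<close> weighs \<open>\<mu> i\<close>, an up step
  to \<open>i\<close> weighs \<open>\<nu> i\<close>, a level step at \<open>i\<close> weighs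
  \<open>- a i\<close>.\<close>

fun path_weight :: "(nat \<Rightarrow> int) \<Rightarrow> (nat \<Rightarrow> int) \<Rightarrow> (nat \<Rightarrow> int) \<Rightarrow> nat \<Rightarrow> nat \<Rightarrow> int" where
  "path_weight a \<mu> \<nu> 0 0 = 1"
| "path_weight a \<mu> \<nu> 0 (Suc h) = \<mu> (Suc h) * path_weight a \<mu> \<nu> 0 h"
| "path_weight a \<mu> \<nu> (Suc m) 0 =
     \<nu> 1 * path_weight a \<mu> \<nu> m 1 - a 0 * path_weight a \<mu> \<nu> m 0"
| "path_weight a \<mu> \<nu> (Suc m) (Suc h) = \<mu> (Suc h) * path_weight a \<mu> \<nu> (Suc m) h +
     \<nu> (Suc (Suc h)) * path_weight a \<mu> \<nu> m (Suc (Suc h)) - a (Suc h) * path_weight a \<mu> \<nu> m (Suc h)"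

lemma cf_denom_nth_0 [simp]: "fps_nth (cf_denom a l k i) 0 = 1"
proof (induction k arbitrary: i)
  case (Suc k)
  then have "fps_nth (fps_X / cf_denom a l k (Suc i)) 0 = 0"
    by (simp add: fps_divide_unit)
  moreover have "of_int (l (i + 1)) * fps_X / cf_denom a l k (i + 1) =
      of_int (l (i + 1)) * (fps_X / cf_denom a l k (Suc i))"
    using Suc by (simp add: fps_divide_unit mult.assoc)
  ultimately show ?case by simp
qed simp

text \<open>The product of the inverse tails of the depth-\<open>k\<close> truncation at levels
  \<open>0\<close> to \<open>h\<close>, with the down weights between them: a finite-depth version
  of the generating function in \<open>m\<close> of \<open>path_weight\<close> at height
  \<open>h\<close>.\<close>

fun partial_path :: "(nat \<Rightarrow> int) \<Rightarrow> (nat \<Rightarrow> int) \<Rightarrow> (nat \<Rightarrow> int) \<Rightarrow> nat \<Rightarrow> nat \<Rightarrow> rat fps" where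
  "partial_path a l \<mu> k 0 = inverse (cf_denom a l k 0)"
| "partial_path a l \<mu> k (Suc h) =
     of_int (\<mu> (Suc h)) * partial_path a l \<mu> k h * inverse (cf_denom a l (k - Suc h) (Suc h))"

text \<open>Multiply by the tail at level \<open>h\<close> and expand it once. Since \<lambda> is
  the product of \<mu> and \<nu>, the fraction in the tail turns into the series one level
  higher.\<close>

lemma partial_path_rec:
  assumes l: "\<And>i. l (Suc i) = \<mu> (Suc i) * \<nu> (Suc i)" and h: "h < k"
  shows "partial_path a l \<mu> k h = (case h of 0 \<Rightarrow> 1 | Suc g \<Rightarrow> of_int (\<mu> h) * partial_path a l \<mu> k g) +
    fps_X * (of_int (\<nu> (Suc h)) * partial_path a l \<mu> k (Suc h) - of_int (a h) * partial_path a l \<mu> k h)"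
    (is "?S = ?P + _")
proof -
  let ?D = "cf_denom a l (k - h) h" and ?E = "cf_denom a l (k - Suc h) (Suc h)"
  have k: "k - h = Suc (k - Suc h)" using h by simp
  have D: "?D = 1 + of_int (a h) * fps_X - of_int (l (Suc h)) * fps_X * inverse ?E"
    unfolding k by (simp add: fps_divide_unit)
  have "?S = ?P * inverse ?D"
    by (cases h) simp_all
  then have "?S * ?D = ?P * (inverse ?D * ?D)" by (simp only: mult.assoc)
  also have "inverse ?D * ?D = 1" by (rule inverse_mult_eq_1) simp
  finally have "?P = ?S * ?D" by simp
  also have "\<dots> = ?S + fps_X * (of_int (a h) * ?S) -
      fps_X * (of_int (\<nu> (Suc h)) * (of_int (\<mu> (Suc h)) * ?S * inverse ?E))"
    unfolding D l by (simp add: algebra_simps)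
  also have "of_int (\<mu> (Suc h)) * ?S * inverse ?E = partial_path a l \<mu> k (Suc h)" by simp
  finally show ?thesis by (simp add: algebra_simps)
qed

text \<open>The bound \<open>m + h \<le> k\<close> survives every recursive call, and for positive
  \<open>m\<close> it gives the \<open>h < k\<close> that the recursion of the series needs.\<close>

lemma partial_path_nth:
  assumes "\<And>i. l (Suc i) = \<mu> (Suc i) * \<nu> (Suc i)" and "m + h \<le> k"
  shows "fps_nth (partial_path a l \<mu> k h) m = of_int (path_weight a \<mu> \<nu> m h)"
  using assms
proof (induction a \<mu> \<nu> m h rule: path_weight.induct)
  case (3 a \<mu> \<nu> m)
  have "partial_path a l \<mu> k 0 = 1 + fps_X * (of_int (\<nu> 1) * partial_path a l \<mu> k 1 -
      of_int (a 0) * partial_path a l \<mu> k 0)"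
    using partial_path_rec[of l \<mu> \<nu> 0 k a] 3 by simp
  from arg_cong[OF this, of "\<lambda>f. fps_nth f (Suc m)"] show ?case
    using 3 by (simp del: partial_path.simps)
next
  case (4 a \<mu> \<nu> m h)
  have "partial_path a l \<mu> k (Suc h) = of_int (\<mu> (Suc h)) * partial_path a l \<mu> k h +
      fps_X * (of_int (\<nu> (Suc (Suc h))) * partial_path a l \<mu> k (Suc (Suc h)) -
        of_int (a (Suc h)) * partial_path a l \<mu> k (Suc h))"
    using partial_path_rec[of l \<mu> \<nu> "Suc h" k a] 4 by (simp del: partial_path.simps)
  from arg_cong[OF this, of "\<lambda>f. fps_nth f (Suc m)"] show ?case
    using 4 by (simp del: partial_path.simps)
qed simp_all

text \<open>Only the products of down and up weights enter the fraction, so the factors can be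
  chosen to match the counting recurrence.\<close>

lemma cont_frac_eq_path_weight:
  assumes l: "\<And>i. l (Suc i) = \<mu> (Suc i) * \<nu> (Suc i)"
  shows "cont_frac a l = Abs_fps (\<lambda>n. of_int (path_weight a \<mu> \<nu> n 0))"
  unfolding cont_frac_def
proof (rule limI, rule tendsto_fpsI)
  fix n
  have "fps_nth (cf_truncation a l k) n = of_int (path_weight a \<mu> \<nu> n 0)" if "n \<le> k" for k
    using partial_path_nth[of l \<mu> \<nu> n 0 k a] l that
    unfolding cf_truncation_def by (simp add: fps_divide_unit)
  then show "\<forall>\<^sub>F k in sequentially. fps_nth (cf_truncation a l k) n =
      fps_nth (Abs_fps (\<lambda>n. of_int (path_weight a \<mu> \<nu> n 0))) n"
    unfolding eventually_sequentially by (intro exI[of _ n]) simp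
qed

section \<open>Counting ideals\<close>

text \<open>
  If no cell of column \<open>a - 1\<close> in the rows from \<open>r\<close> on contains all its items, then the items 3 of
  that column, except those that are also lowest, are what still affects the columns from \<open>a\<close> on.
\<close>

definition region :: "bool \<Rightarrow> nat \<Rightarrow> nat \<Rightarrow> nat \<Rightarrow> item set" where
  "region b n a r = {(i, j, t). (i, j, t) \<in> items b n \<and> r \<le> i \<and>
     (a \<le> j \<or> Suc j = a \<and> t = 3 \<and> lowest b i j \<noteq> 3)}"

definition row_items :: "bool \<Rightarrow> nat \<Rightarrow> nat \<Rightarrow> nat \<Rightarrow> item set" where
  "row_items b n a r = {(i, j, t). (i, j, t) \<in> items b n \<and> i = r \<and> a \<le> j}"

definition pending :: "bool \<Rightarrow> nat \<Rightarrow> nat \<Rightarrow> nat \<Rightarrow> item set" where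
  "pending b n a r = {(i, j, t). (i, j, t) \<in> items b n \<and> i = r \<and> Suc j = a \<and> t = 3 \<and> lowest b i j \<noteq> 3}"

text \<open>The items of column \<open>a\<close> that remain unconstrained once its cells from row
  \<open>r\<close> down are not complete, apart from items 3, which still act on the next column.
  Below row \<open>r\<close> lowest items are excluded, since they would fill the cell
  above.\<close>

definition column_items :: "bool \<Rightarrow> nat \<Rightarrow> nat \<Rightarrow> nat \<Rightarrow> item set" where
  "column_items b n a r = {(i, j, t). (i, j, t) \<in> items b n \<and> r \<le> i \<and> j = a \<and> t \<noteq> 3 \<and> (i = r \<or> t = 2)}"

abbreviation ideals :: "bool \<Rightarrow> item set \<Rightarrow> item set set" where
  "ideals b Q \<equiv> {I. forcing_closed b Q I}"

lemma region_subset: "region b n a r \<subseteq> items b n"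
  unfolding region_def by blast

lemma finite_region: "finite (region b n a r)"
  by (rule finite_subset[OF region_subset finite_items])

lemma finite_ideals: "finite (ideals b (region b n a r))"
proof (rule finite_subset)
  show "ideals b (region b n a r) \<subseteq> Pow (region b n a r)" unfolding forcing_closed_def by blast
qed (simp add: finite_region)

lemma forcing_closed_Int:
  "forcing_closed b Q I \<Longrightarrow> R \<subseteq> Q \<Longrightarrow> forcing_closed b R (I \<inter> R)"
  unfolding forcing_closed_def by blast

lemma region_split:
  "region b n a r = pending b n a r \<union> row_items b n a r \<union> region b n a (Suc r)"
  unfolding region_def pending_def row_items_def by (auto simp: Suc_le_eq)

text \<open>Once row \<open>r\<close> is full, all that it forces inside the region is present, and
  every forcing from row \<open>r + 1\<close> into row \<open>r\<close> is satisfied. Nothing in the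
  region forces a pending item, so that choice is free.\<close>

lemma card_ideals_row:
  assumes P: "P \<subseteq> pending b n a r"
  shows "card {I \<in> ideals b (region b n a r). row_items b n a r \<subseteq> I \<and> I \<inter> pending b n a r = P} =
    card (ideals b (region b n a (Suc r)))"
proof -
  let ?R = "row_items b n a r" and ?P = "pending b n a r" and ?Q = "region b n a (Suc r)"
  have disj: "?P \<inter> ?Q = {}" "?R \<inter> ?Q = {}" "?P \<inter> ?R = {}"
    unfolding region_def pending_def row_items_def by auto
  have ext: "forcing_closed b (region b n a r) (P \<union> ?R \<union> I)" if I: "forcing_closed b ?Q I" for I
    unfolding forcing_closed_def
  proof (intro conjI allI impI)
    show "P \<union> ?R \<union> I \<subseteq> region b n a r"
      using P forcing_closedD(1)[OF I] region_split by blast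
    fix i j t
    {
      assume *: "(i, j, 3) \<in> P \<union> ?R \<union> I \<and> (i, Suc j, t) \<in> region b n a r"
      show "(i, Suc j, t) \<in> P \<union> ?R \<union> I"
      proof (cases "i = r")
        case True
        have "(i, j, 3) \<in> region b n a r" using * P forcing_closedD(1)[OF I] region_split by blast
        then have "a \<le> Suc j" unfolding region_def by auto
        then show ?thesis using * True unfolding row_items_def region_def by auto
      next
        case False
        then have "(i, j, 3) \<in> I" "(i, Suc j, t) \<in> ?Q"
          using * P unfolding row_items_def region_def pending_def by auto
        then show ?thesis using forcing_closedD(2)[OF I] by blast
      qed
    next
      assume *: "(Suc i, j, lowest b (Suc i) j) \<in> P \<union> ?R \<union> I \<and> (i, j, t) \<in> region b n a r"
      then have "r \<le> i" unfolding region_def by auto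
      then have mem: "(Suc i, j, lowest b (Suc i) j) \<in> I"
        using * P unfolding row_items_def pending_def by auto
      then have "(Suc i, j, lowest b (Suc i) j) \<in> ?Q" using forcing_closedD(1)[OF I] by blast
      then have "a \<le> j" unfolding region_def by auto
      show "(i, j, t) \<in> P \<union> ?R \<union> I"
      proof (cases "i = r")
        case True
        then show ?thesis using * \<open>a \<le> j\<close> unfolding row_items_def region_def by auto
      next
        case False
        then have "(i, j, t) \<in> ?Q" using * \<open>r \<le> i\<close> unfolding region_def by auto
        then show ?thesis using forcing_closedD(3)[OF I mem] by blast
      qed
    }
  qed
  have "bij_betw (\<lambda>I. I \<inter> ?Q) {I \<in> ideals b (region b n a r). ?R \<subseteq> I \<and> I \<inter> ?P = P} (ideals b ?Q)"
  proof (rule bij_betw_byWitness[where f' = "\<lambda>I. P \<union> ?R \<union> I"])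
    show "\<forall>I\<in>{I \<in> ideals b (region b n a r). ?R \<subseteq> I \<and> I \<inter> ?P = P}. P \<union> ?R \<union> I \<inter> ?Q = I"
      using forcing_closedD(1) region_split[of b n a r] by blast
    show "\<forall>I\<in>ideals b ?Q. (P \<union> ?R \<union> I) \<inter> ?Q = I"
      using forcing_closedD(1) disj P by blast
    show "(\<lambda>I. I \<inter> ?Q) ` {I \<in> ideals b (region b n a r). ?R \<subseteq> I \<and> I \<inter> ?P = P} \<subseteq> ideals b ?Q"
      using forcing_closed_Int[of b "region b n a r" _ ?Q] region_split[of b n a r] by auto
    show "(\<lambda>I. P \<union> ?R \<union> I) ` ideals b ?Q \<subseteq> {I \<in> ideals b (region b n a r). ?R \<subseteq> I \<and> I \<inter> ?P = P}"
    proof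
      fix K assume "K \<in> (\<lambda>I. P \<union> ?R \<union> I) ` ideals b ?Q"
      then obtain I where I: "K = P \<union> ?R \<union> I" "forcing_closed b ?Q I" by blast
      have "(P \<union> ?R \<union> I) \<inter> ?P = P" using forcing_closedD(1)[OF I(2)] disj P by blast
      then show "K \<in> {I \<in> ideals b (region b n a r). ?R \<subseteq> I \<and> I \<inter> ?P = P}"
        using I ext by auto
    qed
  qed
  then show ?thesis by (rule bij_betw_same_card)
qed

lemma card_ideals_full_row:
  "card {I \<in> ideals b (region b n a r). row_items b n a r \<subseteq> I} =
   2 ^ card (pending b n a r) * card (ideals b (region b n a (Suc r)))"
proof -
  let ?P = "pending b n a r"
  let ?A = "\<lambda>P. {I \<in> ideals b (region b n a r). row_items b n a r \<subseteq> I \<and> I \<inter> ?P = P}"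
  have fin: "finite ?P" using finite_region[of b n a r] region_split[of b n a r] by (metis finite_Un)
  have "{I \<in> ideals b (region b n a r). row_items b n a r \<subseteq> I} = (\<Union>P\<in>Pow ?P. ?A P)" by auto
  also have "card \<dots> = (\<Sum>P\<in>Pow ?P. card (?A P))"
    by (rule card_UN_disjoint) (use fin finite_ideals in auto)
  also have "\<dots> = (\<Sum>P\<in>Pow ?P. card (ideals b (region b n a (Suc r))))"
    by (intro sum.cong refl card_ideals_row) simp
  also have "\<dots> = 2 ^ card ?P * card (ideals b (region b n a (Suc r)))"
    using fin by (simp add: card_Pow)
  finally show ?thesis .
qed

text \<open>A complete cell contains its item 3, which forces the next cell of the row to be
  complete.\<close>

lemma row_subset_iff:
  assumes I: "forcing_closed b (region b n a r) I" and r: "2 \<le> r" "r \<le> Suc a"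
  shows "row_items b n a r \<subseteq> I \<longleftrightarrow> (\<forall>t. (r, a, t) \<in> items b n \<longrightarrow> (r, a, t) \<in> I)"
proof
  assume *: "\<forall>t. (r, a, t) \<in> items b n \<longrightarrow> (r, a, t) \<in> I"
  have "(r, j, t) \<in> I" if "a \<le> j" "(r, j, t) \<in> items b n" for j t
    using that
  proof (induction j arbitrary: t rule: dec_induct)
    case base
    then show ?case using * by blast
  next
    case (step j)
    have "(r, j, 3) \<in> items b n" using step r by (auto simp: items_def)
    moreover have "(r, Suc j, t) \<in> region b n a r" using step unfolding region_def by auto
    ultimately show ?case using step forcing_closedD(2)[OF I] by blast
  qed
  then show "row_items b n a r \<subseteq> I" unfolding row_items_def by auto
qed (auto simp: row_items_def)

lemma pending_row:
  assumes I: "forcing_closed b (region b n a r) I" and "pending b n a r \<noteq> {}" "pending b n a r \<subseteq> I"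
  shows "row_items b n a r \<subseteq> I"
proof -
  obtain j where j: "Suc j = a" "(r, j, 3) \<in> items b n" "(r, j, 3) \<in> I"
    using assms(2,3) unfolding pending_def by auto
  have r: "2 \<le> r" "r \<le> Suc a" using j unfolding items_def by auto
  show ?thesis
    unfolding row_subset_iff[OF I r]
  proof (intro allI impI)
    fix t assume "(r, a, t) \<in> items b n"
    then have "(r, Suc j, t) \<in> region b n a r" using j unfolding region_def by auto
    then show "(r, a, t) \<in> I" using forcing_closedD(2)[OF I j(3)] j(1) by blast
  qed
qed

lemma card_extensions:
  assumes "finite V" "finite R" "V \<inter> R = {}" "V\<^sub>0 \<subseteq> V"
  shows "card {I. I \<subseteq> V \<union> R \<and> I \<inter> R \<in> \<Q> \<and> V\<^sub>0 \<subseteq> I} =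
    2 ^ card (V - V\<^sub>0) * card {Z \<in> \<Q>. Z \<subseteq> R}"
proof -
  have "bij_betw (\<lambda>I. (I \<inter> (V - V\<^sub>0), I \<inter> R)) {I. I \<subseteq> V \<union> R \<and> I \<inter> R \<in> \<Q> \<and> V\<^sub>0 \<subseteq> I}
      (Pow (V - V\<^sub>0) \<times> {Z \<in> \<Q>. Z \<subseteq> R})"
  proof (rule bij_betw_byWitness[where f' = "\<lambda>(W, Z). V\<^sub>0 \<union> W \<union> Z"])
    show "\<forall>x\<in>Pow (V - V\<^sub>0) \<times> {Z \<in> \<Q>. Z \<subseteq> R}.
      ((case x of (W, Z) \<Rightarrow> V\<^sub>0 \<union> W \<union> Z) \<inter> (V - V\<^sub>0), (case x of (W, Z) \<Rightarrow> V\<^sub>0 \<union> W \<union> Z) \<inter> R) = x"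
      using assms(3,4) by (auto 0 3)
    show "(\<lambda>(W, Z). V\<^sub>0 \<union> W \<union> Z) ` (Pow (V - V\<^sub>0) \<times> {Z \<in> \<Q>. Z \<subseteq> R})
        \<subseteq> {I. I \<subseteq> V \<union> R \<and> I \<inter> R \<in> \<Q> \<and> V\<^sub>0 \<subseteq> I}"
    proof clarify
      fix W Z assume *: "W \<subseteq> V - V\<^sub>0" "Z \<in> \<Q>" "Z \<subseteq> R"
      then have "(V\<^sub>0 \<union> W \<union> Z) \<inter> R = Z" using assms(3,4) by blast
      then show "V\<^sub>0 \<union> W \<union> Z \<subseteq> V \<union> R \<and> (V\<^sub>0 \<union> W \<union> Z) \<inter> R \<in> \<Q> \<and> V\<^sub>0 \<subseteq> V\<^sub>0 \<union> W \<union> Z"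
        using * assms(4) by auto
    qed
  qed (use assms in auto)
  then have "card {I. I \<subseteq> V \<union> R \<and> I \<inter> R \<in> \<Q> \<and> V\<^sub>0 \<subseteq> I} =
      card (Pow (V - V\<^sub>0) \<times> {Z \<in> \<Q>. Z \<subseteq> R})"
    by (rule bij_betw_same_card)
  then show ?thesis using assms(1) by (simp add: card_cartesian_product card_Pow)
qed

text \<open>If the first cell of row \<open>r\<close> is incomplete, so is every cell below it in
  column \<open>a\<close>, since a lowest item would complete the cell above. Hence no pending item
  of column \<open>a - 1\<close> is present, as it would complete its neighbour. What is left of
  column \<open>a\<close> is \<open>V\<close>, which is free, and the items 3 pending for column
  \<open>a + 1\<close>.\<close>

lemma not_full_row_eq:
  fixes b :: bool
  assumes r: "2 \<le> r" "r \<le> Suc a" "a < n"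
  defines "V \<equiv> column_items b n a r" and "R \<equiv> region b n (Suc a) r"
  shows "{I \<in> ideals b (region b n a r). \<not> row_items b n a r \<subseteq> I} =
    {I. I \<subseteq> V \<union> R \<and> I \<inter> R \<in> ideals b R \<and> \<not> {(r, a, t) |t. (r, a, t) \<in> items b n} \<subseteq> I}"
proof (intro Set.set_eqI iffI)
  fix I assume "I \<in> {I \<in> ideals b (region b n a r). \<not> row_items b n a r \<subseteq> I}"
  then have I: "forcing_closed b (region b n a r) I" and n: "\<not> row_items b n a r \<subseteq> I" by auto
  have top: "\<not> (\<forall>t. (r, a, t) \<in> items b n \<longrightarrow> (r, a, t) \<in> I)"
    using n row_subset_iff[OF I r(1,2)] by blast
  have tri: "(i, a, lowest b i a) \<in> items b n" if "r \<le> i" "i \<le> Suc a" for i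
    using that r unfolding items_def lowest_def by auto
  have up: "(i, a, lowest b i a) \<notin> I" if "Suc r \<le> i" "i \<le> Suc a" for i
    using that
  proof (induction i rule: dec_induct)
    case base
    then show ?case using top forcing_closedD(3)[OF I, of r a] unfolding region_def by auto
  next
    case (step i)
    have "(i, a, lowest b i a) \<in> region b n a r" using step tri[of i] unfolding region_def by auto
    then show ?case using step forcing_closedD(3)[OF I, of i a "lowest b i a"] by auto
  qed
  have cell: "\<exists>t. (i, a, t) \<in> items b n \<and> (i, a, t) \<notin> I" if "r \<le> i" "i \<le> Suc a" for i
    using top up[of i] tri[of i] that by (cases "i = r") auto
  have "I \<subseteq> V \<union> R"
  proof
    fix x assume x: "x \<in> I"
    obtain i j t where ijt: "x = (i, j, t)" by (cases x)
    have reg: "(i, j, t) \<in> region b n a r" using x forcing_closedD(1)[OF I] unfolding ijt by blast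
    then have it: "(i, j, t) \<in> items b n" "r \<le> i" "i \<le> Suc j" unfolding region_def items_def by auto
    consider "Suc a \<le> j" | "Suc j = a" "t = 3" | "j = a" using reg unfolding region_def by force
    then show "x \<in> V \<union> R"
    proof cases
      case 1
      then show ?thesis using it unfolding ijt R_def region_def by auto
    next
      case 2
      have "(i, a, s) \<in> I" if "(i, a, s) \<in> items b n" for s
        using forcing_closedD(2)[OF I, of i j s] x 2 that it unfolding ijt region_def by auto
      then show ?thesis using cell[of i] it 2 by auto
    next
      case 3
      have low: "lowest b i a \<noteq> t \<or> i = r"
        using up[of i] x it 3 unfolding ijt by (cases "i = r") auto
      show ?thesis
      proof (cases "t = 3")
        case True
        \<comment> \<open>Otherwise item 3 is the only item of the cell and its presence would
          complete it.\<close>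
        have "lowest b i a \<noteq> 3"
        proof
          assume l: "lowest b i a = 3"
          then have "i = r" using low True by simp
          moreover have "s = 3" if "(i, a, s) \<in> items b n" for s
            using lowest_le[OF that] top_item[OF that] l by simp
          ultimately show False using top x 3 True unfolding ijt by auto
        qed
        then show ?thesis using it 3 True unfolding ijt R_def region_def by auto
      next
        case False
        then have "t = 2 \<or> t = lowest b i a" using it 3 unfolding items_def lowest_def by auto
        then have "i = r \<or> t = 2" using low by auto
        then show ?thesis using it 3 False unfolding ijt V_def column_items_def by auto
      qed
    qed
  qed
  moreover have "R \<subseteq> region b n a r" unfolding R_def region_def by auto
  then have "forcing_closed b R (I \<inter> R)" using forcing_closed_Int[OF I] by blast
  ultimately show "I \<in> {I. I \<subseteq> V \<union> R \<and> I \<inter> R \<in> ideals b R \<and>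
      \<not> {(r, a, t) |t. (r, a, t) \<in> items b n} \<subseteq> I}"
    using top by auto
next
  fix I assume "I \<in> {I. I \<subseteq> V \<union> R \<and> I \<inter> R \<in> ideals b R \<and>
      \<not> {(r, a, t) |t. (r, a, t) \<in> items b n} \<subseteq> I}"
  then have sub: "I \<subseteq> V \<union> R" and IR: "forcing_closed b R (I \<inter> R)"
    and top: "\<not> {(r, a, t) |t. (r, a, t) \<in> items b n} \<subseteq> I" by auto
  have "V \<subseteq> region b n a r" "R \<subseteq> region b n a r"
    unfolding V_def R_def region_def column_items_def by auto
  then have "I \<subseteq> region b n a r" using sub by blast
  moreover have "(i, Suc j, t) \<in> I" if "(i, j, 3) \<in> I" "(i, Suc j, t) \<in> region b n a r" for i j t
  proof -
    have m: "(i, j, 3) \<in> I \<inter> R" using that(1) sub unfolding V_def column_items_def by auto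
    then have "(i, Suc j, t) \<in> R" using that(2) unfolding R_def region_def by auto
    then show ?thesis using forcing_closedD(2)[OF IR m] by blast
  qed
  moreover have "(i, j, t) \<in> I"
    if "(Suc i, j, lowest b (Suc i) j) \<in> I" "(i, j, t) \<in> region b n a r" for i j t
  proof -
    have ri: "r \<le> i" using that(2) unfolding region_def by auto
    \<comment> \<open>Below row \<open>r\<close> only items 2 lie in \<open>V\<close>, and 2 is
      never a lowest item, so members of \<open>V\<close> force nothing in the region.\<close>
    have "(Suc i, j, lowest b (Suc i) j) \<notin> V"
      using ri unfolding V_def column_items_def lowest_def by auto
    then have m: "(Suc i, j, lowest b (Suc i) j) \<in> I \<inter> R" using that(1) sub by blast
    then have "Suc a \<le> j" unfolding R_def region_def by auto
    then have "(i, j, t) \<in> R" using that(2) unfolding R_def region_def by auto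
    then show ?thesis using forcing_closedD(3)[OF IR m] by blast
  qed
  ultimately have "forcing_closed b (region b n a r) I" unfolding forcing_closed_def by blast
  moreover have "{(r, a, t) |t. (r, a, t) \<in> items b n} \<subseteq> row_items b n a r"
    unfolding row_items_def by auto
  ultimately show "I \<in> {I \<in> ideals b (region b n a r). \<not> row_items b n a r \<subseteq> I}"
    using top by blast
qed

text \<open>Ideals with a full row \<open>r\<close> reduce to the next row. For the others, choose
  freely on \<open>V\<close> and an ideal on the next column's region, then subtract the choices
  that complete \<open>(r, a)\<close>. These contain its item 3, which fills row \<open>r\<close> of
  the smaller region, so row and column both disappear.\<close>

lemma card_ideals_recurrence:
  fixes b :: bool
  assumes r: "2 \<le> r" "r \<le> Suc a" "a < n"
  defines "V \<equiv> column_items b n a r"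
  shows "card (ideals b (region b n a r)) + (if lowest b r a = 3 then 0
       else 2 ^ card {(i, j, t) \<in> V. i \<noteq> r} * card (ideals b (region b n (Suc a) (Suc r)))) =
    2 ^ card (pending b n a r) * card (ideals b (region b n a (Suc r))) +
    2 ^ card V * card (ideals b (region b n (Suc a) r))"
proof -
  let ?R = "region b n (Suc a) r" and ?top = "{(r, a, t) |t. (r, a, t) \<in> items b n}"
  let ?full = "{I \<in> ideals b (region b n a r). row_items b n a r \<subseteq> I}"
  let ?non = "{I \<in> ideals b (region b n a r). \<not> row_items b n a r \<subseteq> I}"
  let ?S = "{I. I \<subseteq> V \<union> ?R \<and> I \<inter> ?R \<in> ideals b ?R \<and> {} \<subseteq> I}"
  define V\<^sub>0 where "V\<^sub>0 = {(i, j, t) \<in> V. i = r}"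
  define \<Q> where "\<Q> = {Z \<in> ideals b ?R. (r, a, 3) \<in> Z}"
  let ?E = "{I. I \<subseteq> V \<union> ?R \<and> I \<inter> ?R \<in> \<Q> \<and> V\<^sub>0 \<subseteq> I}"
  have finV: "finite V" unfolding V_def column_items_def
    by (rule finite_subset[OF _ finite_items[of b n]]) auto
  have disj: "V \<inter> ?R = {}" unfolding V_def column_items_def region_def by auto
  have "ideals b (region b n a r) = ?full \<union> ?non" by blast
  then have "card (ideals b (region b n a r)) = card (?full \<union> ?non)" by (rule arg_cong)
  also have "\<dots> = card ?full + card ?non"
    by (rule card_Un_disjoint) (use finite_ideals[of b n a r] in auto)
  finally have 1: "card (ideals b (region b n a r)) =
      2 ^ card (pending b n a r) * card (ideals b (region b n a (Suc r))) + card ?non"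
    unfolding card_ideals_full_row .
  have "{Z \<in> ideals b ?R. Z \<subseteq> ?R} = ideals b ?R" unfolding forcing_closed_def by blast
  then have 2: "card ?S = 2 ^ card V * card (ideals b ?R)"
    using card_extensions[OF finV finite_region[of b n "Suc a" r] disj, of "{}" "ideals b ?R"] by simp
  have non: "?non = {I \<in> ?S. \<not> ?top \<subseteq> I}"
    using not_full_row_eq[OF r] unfolding V_def by auto
  have finS: "finite ?S"
    by (rule finite_subset[of _ "Pow (V \<union> ?R)"]) (use finV finite_region in auto)
  have t3: "(r, a, 3) \<in> items b n" using r unfolding items_def by auto
  show ?thesis
  proof (cases "lowest b r a = 3")
    case True
    then have "(r, a, 3) \<notin> V \<union> ?R" unfolding V_def column_items_def region_def by auto
    then have "?non = ?S" unfolding non using t3 by blast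
    then show ?thesis using 1 2 True by simp
  next
    case False
    have pend: "pending b n (Suc a) r = {(r, a, 3)}"
      using t3 False unfolding pending_def by auto
    have tR: "(r, a, 3) \<in> ?R" using t3 False unfolding region_def by auto
    have V0: "V\<^sub>0 = ?top - {(r, a, 3)}" unfolding V\<^sub>0_def V_def column_items_def by auto
    have E: "?E = {I \<in> ?S. ?top \<subseteq> I}"
      unfolding \<Q>_def V0 using tR t3 by auto
    have diff: "card A + card B = card S" if "finite S" "B \<subseteq> S" "A = S - B" for A B S :: "item set set"
      using that by (simp add: card_Diff_subset card_mono finite_subset)
    have 3: "card ?non + card ?E = card ?S"
    proof (rule diff[OF finS])
      show "?E \<subseteq> ?S" unfolding E by blast
      show "?non = ?S - ?E" unfolding non E by blast
    qed
    have "{Z \<in> \<Q>. Z \<subseteq> ?R} = {I \<in> ideals b ?R. row_items b n (Suc a) r \<subseteq> I \<and>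
        I \<inter> pending b n (Suc a) r = pending b n (Suc a) r}"
      using pending_row[of b n "Suc a" r] unfolding \<Q>_def pend
      by (auto dest: forcing_closedD(1)[THEN subsetD])
    then have "card {Z \<in> \<Q>. Z \<subseteq> ?R} = card (ideals b (region b n (Suc a) (Suc r)))"
      using card_ideals_row[of "pending b n (Suc a) r" b n "Suc a" r] by simp
    moreover have "V - V\<^sub>0 = {(i, j, t) \<in> V. i \<noteq> r}" unfolding V\<^sub>0_def by auto
    moreover have "V\<^sub>0 \<subseteq> V" unfolding V\<^sub>0_def by auto
    ultimately have "card ?E = 2 ^ card {(i, j, t) \<in> V. i \<noteq> r} * card (ideals b (region b n (Suc a) (Suc r)))"
      using card_extensions[OF finV finite_region[of b n "Suc a" r] disj, of V\<^sub>0 \<Q>] by simp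
    then show ?thesis using 1 2 3 False by simp
  qed
qed

section \<open>Weights and the resulting continued fractions\<close>

lemma card_pending:
  assumes "2 \<le> r" "1 \<le> a" "a \<le> n"
  shows "card (pending b n a r) = (if r < a \<or> b \<and> r = a then 1 else 0)"
proof -
  have "pending b n a r = (if r < a \<or> b \<and> r = a then {(r, a - 1, 3)} else {})"
    using assms unfolding pending_def items_def lowest_def by (auto split: if_splits)
  then show ?thesis by simp
qed

lemma card_column_items:
  assumes "2 \<le> r" "r \<le> Suc a" "a < n"
  shows "card (column_items b n a r) = (if r \<le> a \<or> b then 1 else 0) + (if b then Suc a - r else 0)"
    and "card {(i, j, t) \<in> column_items b n a r. i \<noteq> r} = (if b then a - r else 0)"
proof -
  let ?f = "\<lambda>i. (i, a, 2::nat)"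
  have inj: "inj_on ?f A" for A by (rule inj_onI) simp
  have "column_items b n a r = (if r \<le> a \<or> b then {(r, a, 1)} else {}) \<union> (if b then ?f ` {r..a} else {})"
    using assms unfolding column_items_def items_def by auto
  moreover have "{(r, a, 1)} \<inter> ?f ` {r..a} = {}" by auto
  ultimately show "card (column_items b n a r) =
      (if r \<le> a \<or> b then 1 else 0) + (if b then Suc a - r else 0)"
    using card_image[OF inj, of "{r..a}"] by (auto simp: card_insert_if)
  have "{(i, j, t) \<in> column_items b n a r. i \<noteq> r} = (if b then ?f ` {Suc r..a} else {})"
    using assms unfolding column_items_def items_def by auto
  then show "card {(i, j, t) \<in> column_items b n a r. i \<noteq> r} = (if b then a - r else 0)"
    using card_image[OF inj, of "{Suc r..a}"] by auto
qed

text \<open>The three weights are the powers of two in the recurrence, read at height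
  \<open>h = a + 2 - r\<close>: level and down at \<open>h\<close>, up at \<open>h + 1\<close>.
  Height 0 is added so that the paths can start there.\<close>

definition level_weight :: "bool \<Rightarrow> nat \<Rightarrow> int" where
  "level_weight b i = (if b then if i = 0 then 0 else if i = 1 then 1 else 2 ^ (i - 2)
     else if i \<le> 1 then 0 else 1)"

definition down_weight :: "bool \<Rightarrow> nat \<Rightarrow> int" where
  "down_weight b i = (if i \<le> (if b then 1 else 2) then 1 else 2)"

definition up_weight :: "bool \<Rightarrow> nat \<Rightarrow> int" where
  "up_weight b i = (if b then 2 ^ (i - 1) else if i \<le> 2 then 1 else 2)"

lemma card_ideals_empty: "card (ideals b {}) = 1"
proof -
  have "ideals b {} = {{}}" unfolding forcing_closed_def by auto
  then show ?thesis by simp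
qed

text \<open>Here \<open>m\<close> counts the remaining columns and \<open>h\<close> the cells of
  column \<open>a\<close> from row \<open>r\<close> down. Removing a row is a down step, a column an
  up step, both a level step.\<close>

lemma card_ideals_region:
  assumes "n = a + m" "r + h = a + 2" "1 \<le> a" "2 \<le> r"
  shows "int (card (ideals b (region b n a r))) =
    path_weight (level_weight b) (down_weight b) (up_weight b) m h"
  using assms
proof (induction "level_weight b" "down_weight b" "up_weight b" m h arbitrary: a r rule: path_weight.induct)
  case 1
  then have "region b n a r = {}" unfolding region_def items_def by auto
  then show ?case by (simp add: card_ideals_empty)
next
  case (2 h)
  have "row_items b n a r = {}" using 2 unfolding row_items_def items_def by auto
  then have "int (card (ideals b (region b n a r))) =
      2 ^ card (pending b n a r) * int (card (ideals b (region b n a (Suc r))))"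
    using card_ideals_full_row[of b n a r] by simp
  moreover have "2 ^ card (pending b n a r) = down_weight b (Suc h)"
    using 2 card_pending[of r a n b] unfolding down_weight_def by auto
  ultimately show ?case using 2 by simp
next
  case (3 m)
  \<comment> \<open>At height 0 row \<open>r\<close> starts below column \<open>a\<close>, so moving
    to the next column removes nothing; hence up weight 1 and level weight 0.\<close>
  have "region b n a r = region b n (Suc a) r"
    using 3 unfolding region_def items_def by auto
  then show ?case using 3 by (simp add: up_weight_def level_weight_def)
next
  case (4 m h)
  have r: "2 \<le> r" "r \<le> Suc a" "a < n" using 4 by auto
  have h: "Suc h = a + 2 - r" using 4 by simp
  have "2 ^ card (pending b n a r) = down_weight b (Suc h)"
    using r h 4 card_pending[of r a n b] unfolding down_weight_def by auto
  moreover have "2 ^ card (column_items b n a r) = up_weight b (Suc (Suc h))"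
    using h r card_column_items(1)[OF r, of b] unfolding up_weight_def
    by (auto simp: Suc_diff_le)
  moreover have "(if lowest b r a = 3 then 0 else 2 ^ card {(i, j, t) \<in> column_items b n a r. i \<noteq> r}) =
      level_weight b (Suc h)"
    using h r card_column_items(2)[OF r, of b] unfolding level_weight_def lowest_def
    by (auto simp: Suc_diff_le)
  moreover have "int (card (ideals b (region b n a (Suc r)))) =
      path_weight (level_weight b) (down_weight b) (up_weight b) (Suc m) h"
    "int (card (ideals b (region b n (Suc a) r))) =
      path_weight (level_weight b) (down_weight b) (up_weight b) m (Suc (Suc h))"
    "int (card (ideals b (region b n (Suc a) (Suc r)))) =
      path_weight (level_weight b) (down_weight b) (up_weight b) m (Suc h)"
    using 4 by simp_all
  moreover have "int (card (ideals b (region b n a r))) +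
      (if lowest b r a = 3 then 0 else 2 ^ card {(i, j, t) \<in> column_items b n a r. i \<noteq> r}) *
        int (card (ideals b (region b n (Suc a) (Suc r)))) =
      2 ^ card (pending b n a r) * int (card (ideals b (region b n a (Suc r)))) +
      2 ^ card (column_items b n a r) * int (card (ideals b (region b n (Suc a) r)))"
    using arg_cong[OF card_ideals_recurrence[OF r, of b], of int] by (simp split: if_splits)
  ultimately show ?case by simp
qed

lemma card_ideals_items:
  assumes "1 \<le> n"
  shows "int (card (ideals b (items b n))) =
    path_weight (level_weight b) (down_weight b) (up_weight b) n 0"
proof -
  have "items b n = region b n 1 2" unfolding region_def items_def by auto
  then have "int (card (ideals b (items b n))) =
      path_weight (level_weight b) (down_weight b) (up_weight b) (n - 1) 1"
    using card_ideals_region[of n 1 "n - 1" 2 1 b] assms by simp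
  \<comment> \<open>From height 0 only the up step of weight 1 contributes; it supplies the first of
    the \<open>n\<close> steps counted.\<close>
  also have "\<dots> = path_weight (level_weight b) (down_weight b) (up_weight b) n 0"
    using assms by (cases n) (simp_all add: up_weight_def level_weight_def)
  finally show ?thesis .
qed

lemma cont_frac_ideals:
  assumes "\<And>i. a i = level_weight b i" "\<And>i. l (Suc i) = down_weight b (Suc i) * up_weight b (Suc i)"
    and f: "f 0 = 1" "\<And>n. 1 \<le> n \<Longrightarrow> f n = card (ideals b (items b n))"
  shows "Abs_fps (\<lambda>n. of_nat (f n)) = cont_frac a l"
proof -
  have "a = level_weight b" using assms(1) by blast
  moreover have "of_nat (f n) =
      (of_int (path_weight (level_weight b) (down_weight b) (up_weight b) n 0) :: rat)" for n
  proof -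
    have "int (f n) = path_weight (level_weight b) (down_weight b) (up_weight b) n 0"
      using f card_ideals_items[of n b] by (cases "n = 0") simp_all
    then show ?thesis by (metis of_int_of_nat_eq)
  qed
  ultimately show ?thesis
    using cont_frac_eq_path_weight[of l "down_weight b" "up_weight b"] assms(2) by simp
qed

theorem theorem1p8:
  shows "Abs_fps (\<lambda>n. of_nat (num_cong_sTam n)) =
           cont_frac (\<lambda>i. if i \<le> 1 then 0 else 1) (\<lambda>i. if i \<le> 2 then 1 else 4)
       \<and> Abs_fps (\<lambda>n. of_nat (num_cong_esTam n)) =
           cont_frac (\<lambda>i. if i = 0 then 0 else if i = 1 then 1 else 2 ^ (i - 2))
                     (\<lambda>i. if i = 1 then 1 else 2 ^ i)"
proof
  show "Abs_fps (\<lambda>n. of_nat (num_cong_sTam n)) =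
      cont_frac (\<lambda>i. if i \<le> 1 then 0 else 1) (\<lambda>i. if i \<le> 2 then 1 else 4)"
    by (rule cont_frac_ideals[where b = False])
       (auto simp: level_weight_def down_weight_def up_weight_def num_cong_sTam_ideals num_cong_0)
  show "Abs_fps (\<lambda>n. of_nat (num_cong_esTam n)) =
      cont_frac (\<lambda>i. if i = 0 then 0 else if i = 1 then 1 else 2 ^ (i - 2))
        (\<lambda>i. if i = 1 then 1 else 2 ^ i)"
    by (rule cont_frac_ideals[where b = True])
       (auto simp: level_weight_def down_weight_def up_weight_def num_cong_esTam_ideals num_cong_0)
qed

end
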